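(* Let $\varepsilon>0$ and let $F$ be an $r$-vertex graph. Then there is some $n_0$ such that the following holds for all $n\geq n_0$. Suppose $\mathfrak{G}=(G_1,\ldots,G_n)$ is a graph collection on $[rn]$ with $|\mathfrak{G}|=n$ and $\delta(\mathfrak{G})\geq (\delta_F+\varepsilon)rn$. Then there are vertex-disjoint copies $F_i$ of $F$ with $F_i\subset G_i$ for each $i\in[n]$.
   Context: A graph collection on a set $V$ is a finite sequence $\mathfrak{G}=(G_1,\ldots,G_m)$ of (not necessarily distinct) graphs, each with vertex set $V$; $|\mathfrak{G}|=m$ and $\delta(\mathfrak{G})=\min_{i}\delta(G_i)$. For a graph $F$, $\delta_F$ is the smallest real number $\delta$ such that for each $\varepsilon>0$ there is $n_0$ such that for every $n\geq n_0$ with $|F|$ dividing $n$, every $n$-vertex graph with minimum degree at least $(\delta+\varepsilon)n$ contains an $F$-factor (a spanning union of vertex-disjoint copies of $F$). *)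

theory Defs
  imports Complex_Main
begin

type_synonym 'a ugraph = "'a set \<times> 'a set set"

abbreviation verts :: "'a ugraph \<Rightarrow> 'a set" where
  "verts G \<equiv> fst G"

abbreviation edges :: "'a ugraph \<Rightarrow> 'a set set" where
  "edges G \<equiv> snd G"

definition simple_graph :: "'a ugraph \<Rightarrow> bool" where
  "simple_graph G \<longleftrightarrow> finite (verts G) \<and> (\<forall>e\<in>edges G. e \<subseteq> verts G \<and> card e = 2)"

definition vdegree :: "'a ugraph \<Rightarrow> 'a \<Rightarrow> nat" where
  "vdegree G v = card {e \<in> edges G. v \<in> e}"

definition min_degree :: "'a ugraph \<Rightarrow> nat" where
  "min_degree G = Min (vdegree G ` verts G)"

definition subgraph :: "'a ugraph \<Rightarrow> 'a ugraph \<Rightarrow> bool" where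
  "subgraph H G \<longleftrightarrow> simple_graph H \<and> verts H \<subseteq> verts G \<and> edges H \<subseteq> edges G"

definition graph_iso :: "'a ugraph \<Rightarrow> 'b ugraph \<Rightarrow> bool" where
  "graph_iso F H \<longleftrightarrow> (\<exists>f. bij_betw f (verts F) (verts H) \<and>
     (\<forall>u\<in>verts F. \<forall>v\<in>verts F. {u, v} \<in> edges F \<longleftrightarrow> {f u, f v} \<in> edges H))"

definition copy_in :: "'a ugraph \<Rightarrow> 'b ugraph \<Rightarrow> 'b ugraph \<Rightarrow> bool" where
  "copy_in F H G \<longleftrightarrow> subgraph H G \<and> graph_iso F H"

definition has_factor :: "'a ugraph \<Rightarrow> 'b ugraph \<Rightarrow> bool" where
  "has_factor F G \<longleftrightarrow> (\<exists>\<H>. (\<forall>H\<in>\<H>. copy_in F H G) \<and>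
     pairwise (\<lambda>H H'. verts H \<inter> verts H' = {}) \<H> \<and>
     (\<Union>H\<in>\<H>. verts H) = verts G)"

text \<open>Host graphs have vertices in \<^typ>\<open>nat\<close>, which covers all finite graphs up to isomorphism.\<close>

definition factor_bound :: "'a ugraph \<Rightarrow> real \<Rightarrow> bool" where
  "factor_bound F \<delta> \<longleftrightarrow> (\<forall>\<epsilon>>0. \<exists>n0. \<forall>n\<ge>n0. card (verts F) dvd n \<longrightarrow>
     (\<forall>G :: nat ugraph. simple_graph G \<and> card (verts G) = n \<and>
        real (min_degree G) \<ge> (\<delta> + \<epsilon>) * real n \<longrightarrow> has_factor F G))"

text \<open>The least such \<open>\<delta>\<close> exists as soon as \<open>F\<close> has an edge (lemma below). If \<open>F\<close> has no edges,
  every real is a bound and the value is unspecified.\<close>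

definition factor_threshold :: "'a ugraph \<Rightarrow> real" where
  "factor_threshold F = (LEAST \<delta>. factor_bound F \<delta>)"

definition graph_collection :: "'a set \<Rightarrow> 'a ugraph list \<Rightarrow> bool" where
  "graph_collection V Gs \<longleftrightarrow> (\<forall>G\<in>set Gs. simple_graph G \<and> verts G = V)"

definition coll_min_degree :: "'a ugraph list \<Rightarrow> nat" where
  "coll_min_degree Gs = Min (min_degree ` set Gs)"

lemma min_degree_less:
  assumes "simple_graph G" "verts G \<noteq> {}"
  shows "min_degree G < card (verts G)"
proof -
  from assms(2) obtain v where v: "v \<in> verts G" by blast
  have fin: "finite (verts G)" using assms(1) by (simp add: simple_graph_def)
  have "{e \<in> edges G. v \<in> e} \<subseteq> (\<lambda>u. {v, u}) ` (verts G - {v})"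
  proof
    fix e assume e: "e \<in> {e \<in> edges G. v \<in> e}"
    then have "e \<subseteq> verts G" "card e = 2" using assms(1) by (auto simp: simple_graph_def)
    then obtain a b where "e = {a, b}" "a \<noteq> b" by (meson card_2_iff)
    then show "e \<in> (\<lambda>u. {v, u}) ` (verts G - {v})" using e \<open>e \<subseteq> verts G\<close> by auto
  qed
  then have "vdegree G v \<le> card ((\<lambda>u. {v, u}) ` (verts G - {v}))"
    unfolding vdegree_def using fin by (intro card_mono) auto
  also have "\<dots> \<le> card (verts G - {v})" using fin by (intro card_image_le) auto
  also have "\<dots> < card (verts G)" using fin v by (rule card_Diff1_less)
  finally have "vdegree G v < card (verts G)" .
  moreover have "min_degree G \<le> vdegree G v"
    unfolding min_degree_def using fin v by (intro Min_le) auto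
  ultimately show ?thesis by simp
qed

lemma factor_bound_1: "factor_bound F 1"
  unfolding factor_bound_def
proof (intro allI impI exI[of _ 1], elim conjE)
  fix \<epsilon> :: real and n :: nat and G :: "nat ugraph"
  assume a: "\<epsilon> > 0" "1 \<le> n" "simple_graph G" "card (verts G) = n"
    "(1 + \<epsilon>) * real n \<le> real (min_degree G)"
  then have "min_degree G < n" using min_degree_less[of G] by fastforce
  moreover have "real n \<le> (1 + \<epsilon>) * real n" using a by (simp add: algebra_simps)
  ultimately show "has_factor F G" using a by linarith
qed

lemma factor_bound_nonneg:
  assumes F: "simple_graph F" "edges F \<noteq> {}" and b: "factor_bound F \<delta>"
  shows "0 \<le> \<delta>"
proof (rule ccontr)
  assume neg: "\<not> 0 \<le> \<delta>"
  then have "- \<delta> / 2 > 0" by simp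
  with b obtain n0 where n0: "\<And>n (G :: nat ugraph). n \<ge> n0 \<Longrightarrow> card (verts F) dvd n \<Longrightarrow>
      simple_graph G \<Longrightarrow> card (verts G) = n \<Longrightarrow>
      real (min_degree G) \<ge> (\<delta> + - \<delta> / 2) * real n \<Longrightarrow> has_factor F G"
    unfolding factor_bound_def by blast
  obtain e where e: "e \<in> edges F" using F by blast
  then obtain a b where ab: "e = {a, b}" "a \<in> verts F" "b \<in> verts F"
    using F unfolding simple_graph_def by (metis card_2_iff insert_subset)
  have pos: "card (verts F) > 0" using F ab by (auto simp: simple_graph_def card_gt_0_iff)
  define n where "n = card (verts F) * (n0 + 1)"
  have n: "n \<ge> n0" "n > 0" using pos by (auto simp: n_def intro: trans_le_add2)
  define G :: "nat ugraph" where "G = ({..<n}, {})"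
  have "has_factor F G"
  proof (rule n0[OF n(1)])
    have "(\<delta> + - \<delta> / 2) * real n \<le> 0" using neg by (intro mult_nonpos_nonneg) auto
    then show "real (min_degree G) \<ge> (\<delta> + - \<delta> / 2) * real n" by linarith
  qed (auto simp: n_def G_def simple_graph_def)
  then obtain \<H> where H: "\<forall>H\<in>\<H>. copy_in F H G" "(\<Union>H\<in>\<H>. verts H) = verts G"
    unfolding has_factor_def by blast
  have "verts G \<noteq> {}" using n by (simp add: G_def lessThan_empty_iff)
  then obtain H where "H \<in> \<H>" using H by blast
  then have c: "copy_in F H G" using H by blast
  then have "edges H = {}" by (auto simp: copy_in_def subgraph_def G_def)
  then show False using c e ab unfolding copy_in_def graph_iso_def by auto
qed

lemma factor_threshold_least:
  assumes "simple_graph F" "edges F \<noteq> {}"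
  shows "factor_bound F (factor_threshold F)"
    and "\<And>\<delta>. factor_bound F \<delta> \<Longrightarrow> factor_threshold F \<le> \<delta>"
proof -
  define S where "S = {\<delta>. factor_bound F \<delta>}"
  have ne: "S \<noteq> {}" using factor_bound_1[of F] unfolding S_def by blast
  have bdd: "bdd_below S" using factor_bound_nonneg[OF assms] by (auto simp: S_def bdd_below_def)
  have "factor_bound F (Inf S)"
    unfolding factor_bound_def
  proof (intro allI impI)
    fix \<epsilon> :: real assume "\<epsilon> > 0"
    then have "Inf S < Inf S + \<epsilon> / 2" by simp
    then obtain d where d: "d \<in> S" "d < Inf S + \<epsilon> / 2" using cInf_lessD[OF ne] by blast
    have "\<epsilon> / 2 > 0" using \<open>\<epsilon> > 0\<close> by simp
    with d(1) obtain n0 where n0: "\<forall>n\<ge>n0. card (verts F) dvd n \<longrightarrow>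
      (\<forall>G :: nat ugraph. simple_graph G \<and> card (verts G) = n \<and>
        real (min_degree G) \<ge> (d + \<epsilon> / 2) * real n \<longrightarrow> has_factor F G)"
      unfolding S_def factor_bound_def by blast
    have le: "(d + \<epsilon> / 2) * real n \<le> (Inf S + \<epsilon>) * real n" for n
      using d(2) by (intro mult_right_mono) auto
    show "\<exists>n0. \<forall>n\<ge>n0. card (verts F) dvd n \<longrightarrow>
      (\<forall>G :: nat ugraph. simple_graph G \<and> card (verts G) = n \<and>
        real (min_degree G) \<ge> (Inf S + \<epsilon>) * real n \<longrightarrow> has_factor F G)"
      using n0 le by (meson order_trans)
  qed
  moreover have "\<And>\<delta>. factor_bound F \<delta> \<Longrightarrow> Inf S \<le> \<delta>"
    using bdd by (auto simp: S_def intro: cInf_lower)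
  moreover from calculation have "factor_threshold F = Inf S"
    unfolding factor_threshold_def by (rule Least_equality)
  ultimately show "factor_bound F (factor_threshold F)"
    and "\<And>\<delta>. factor_bound F \<delta> \<Longrightarrow> factor_threshold F \<le> \<delta>" by auto
qed

end

theory Submission
  imports Defs "HOL-Library.Disjoint_Sets" "HOL-Combinatorics.Multiset_Permutations"
    "HOL-Real_Asymp.Real_Asymp"
begin

text \<open>Split the \<open>r * n\<close> vertices at random into blocks of constant size \<open>r * T\<close>. For almost all pairs
  of a graph and a block, the graph induces on the block a graph whose minimum degree forces an
  \<open>F\<close>-factor. As a block carries only boundedly many labelled graphs, by pigeonhole among boundedly
  many graphs that are good for it some \<open>T\<close> induce the same graph on it, and one
  \<open>F\<close>-factor of that graph serves all \<open>T\<close> of them.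

  To make this exact, first cover the few exceptional graphs and vertices by single copies of \<open>F\<close>,
  then dissolve the blocks that were hit or are exceptional, and add their vertices, \<open>r\<close> at a time,
  to other blocks, which then take \<open>T + 1\<close> graphs each. Every remaining block is given only
  \<open>T - 1\<close> graphs in the greedy phase, which leaves enough spare graphs for the pigeonhole argument
  until its end. Such a block absorbs any further graph that is good for it: remove a copy of \<open>F\<close> of
  the new colour and tile the rest. The spare graphs are finally matched to these blocks, which is
  possible because both sides have few non-neighbours.\<close>

section \<open>Random blocks\<close>

text \<open>The block size is fixed before \<open>n\<close>, so a positive proportion of the pairs
  of a graph and a block may fail however large \<open>n\<close> is. The failure probability decays
  exponentially in \<open>T\<close>, though, while each repair costs only a factor polynomial in
  \<open>r\<close> and \<open>T\<close>: an exceptional colour or vertex takes a copy of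
  \<open>F\<close> that can hit \<open>r\<close> blocks, and a dissolved block releases up to
  \<open>T\<close> sets of size \<open>r\<close>, each of which must enter a block of its own. All
  copies, even a single one through a prescribed vertex, are members of an \<open>F\<close>-factor
  of some large set, so the threshold is the only information about \<open>F\<close> that enters.
  Randomness is handled by counting: tail bounds are proved for lists with repetition, whose entries
  are independent, and passing to permutations costs a factor 2 because the list is short compared
  with the number of vertices. The slack \<epsilon> is cut into four parts \<open>k\<close>: one
  lifts the degrees strictly above the threshold, one pays for the random fluctuation in a block,
  and the last two pay for the enlargement of a block or the removal of a copy from it.\<close>

lemma exp_minus_le_quadratic:
  fixes x :: real
  assumes "0 \<le> x"
  shows "exp (- x) \<le> 1 - x + x\<^sup>2 / 2"
proof -
  define f :: "real \<Rightarrow> real" where "f y = 1 - y + y\<^sup>2 / 2 - exp (- y)" for y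
  have "f 0 \<le> f x"
  proof (rule DERIV_nonneg_imp_nondecreasing[OF assms])
    fix y :: real assume "0 \<le> y"
    have "(f has_real_derivative (- 1 + y + exp (- y))) (at y)"
      unfolding f_def by (auto intro!: derivative_eq_intros)
    moreover have "0 \<le> - 1 + y + exp (- y)" using exp_ge_add_one_self[of "- y"] by linarith
    ultimately show "\<exists>d. (f has_real_derivative d) (at y) \<and> 0 \<le> d" by blast
  qed
  then show ?thesis by (simp add: f_def)
qed

lemma finite_lists_length: "finite V \<Longrightarrow> finite {xs. set xs \<subseteq> V \<and> length xs = l \<and> P xs}"
  by (rule finite_subset[OF _ finite_lists_length_eq[of V l]]) auto

text \<open>Exponential moment bound for the lower tail, written as a count. In the induction a
  first entry in \<open>A\<close> lowers \<open>s\<close> by one, which is worth the factor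
  \<open>exp (- k)\<close>; hence \<open>s\<close> has to be arbitrary.\<close>

lemma card_lists_few_hits:
  fixes k s :: real
  assumes V: "finite V" "A \<subseteq> V" and k: "0 \<le> k"
  shows "real (card {xs. set xs \<subseteq> V \<and> length xs = l \<and> real (length (filter (\<lambda>x. x \<in> A) xs)) < s})
    \<le> exp (k * s) * (real (card A) * exp (- k) + real (card (V - A))) ^ l"
proof (induction l arbitrary: s)
  case 0
  show ?case
  proof (cases "s > 0")
    case True
    then have "{xs. set xs \<subseteq> V \<and> length xs = 0 \<and> real (length (filter (\<lambda>x. x \<in> A) xs)) < s} = {[]}"
      by auto
    then show ?thesis using True k by simp
  next
    case False
    then have "{xs. set xs \<subseteq> V \<and> length xs = 0 \<and> real (length (filter (\<lambda>x. x \<in> A) xs)) < s} = {}"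
      by auto
    then show ?thesis by simp
  qed
next
  case (Suc l)
  define B where "B l s = {xs. set xs \<subseteq> V \<and> length xs = l \<and> real (length (filter (\<lambda>x. x \<in> A) xs)) < s}"
    for l :: nat and s :: real
  define q where "q = real (card A) * exp (- k) + real (card (V - A))"
  have fin: "finite (B l s)" for l s
    unfolding B_def using finite_lists_length[OF V(1)] by auto
  have finA: "finite A" using V by (rule rev_finite_subset)
  have "B (Suc l) s \<subseteq> (\<lambda>(x, xs). x # xs) ` (A \<times> B l (s - 1)) \<union> (\<lambda>(x, xs). x # xs) ` ((V - A) \<times> B l s)"
  proof
    fix ys assume "ys \<in> B (Suc l) s"
    then obtain x xs where "ys = x # xs" "x \<in> V" "set xs \<subseteq> V" "length xs = l"
      "real (length (filter (\<lambda>x. x \<in> A) (x # xs))) < s"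
      unfolding B_def by (cases ys) auto
    then show "ys \<in> (\<lambda>(x, xs). x # xs) ` (A \<times> B l (s - 1)) \<union> (\<lambda>(x, xs). x # xs) ` ((V - A) \<times> B l s)"
      by (cases "x \<in> A") (auto simp: B_def)
  qed
  then have "card (B (Suc l) s) \<le> card ((\<lambda>(x, xs). x # xs) ` (A \<times> B l (s - 1))
      \<union> (\<lambda>(x, xs). x # xs) ` ((V - A) \<times> B l s))"
    using V(1) finA fin by (intro card_mono) (simp_all only: finite_Un finite_imageI finite_cartesian_product finite_Diff)
  also have "\<dots> \<le> card ((\<lambda>(x, xs). x # xs) ` (A \<times> B l (s - 1)))
      + card ((\<lambda>(x, xs). x # xs) ` ((V - A) \<times> B l s))"
    by (rule card_Un_le)
  also have "\<dots> \<le> card (A \<times> B l (s - 1)) + card ((V - A) \<times> B l s)"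
    using V(1) finA fin by (intro add_mono card_image_le) (simp_all only: finite_cartesian_product finite_Diff)
  also have "\<dots> = card A * card (B l (s - 1)) + card (V - A) * card (B l s)"
    by (simp add: card_cartesian_product)
  finally have "real (card (B (Suc l) s)) \<le> real (card A) * real (card (B l (s - 1)))
      + real (card (V - A)) * real (card (B l s))"
    by (metis of_nat_add of_nat_le_iff of_nat_mult)
  also have "\<dots> \<le> real (card A) * (exp (k * (s - 1)) * q ^ l) + real (card (V - A)) * (exp (k * s) * q ^ l)"
    using Suc.IH unfolding B_def q_def by (intro add_mono mult_left_mono) auto
  also have "\<dots> = exp (k * s) * q ^ Suc l"
    by (simp add: q_def algebra_simps exp_diff exp_minus field_simps)
  finally show ?case unfolding B_def q_def .
qed

text \<open>\<open>k - k^2 / 2\<close> bounds \<open>1 - exp (- k)\<close> from below, and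
  \<open>1 + x \<le> exp x\<close> turns the base of the power into an exponential.\<close>

lemma card_lists_few_hits_dense:
  fixes k s a :: real
  assumes V: "finite V" "A \<subseteq> V" and k: "0 \<le> k" "k \<le> 1" and a: "a * card V \<le> card A"
  shows "real (card {xs. set xs \<subseteq> V \<and> length xs = l \<and> real (length (filter (\<lambda>x. x \<in> A) xs)) < s})
    \<le> exp (k * s - a * (k - k\<^sup>2 / 2) * l) * real (card V) ^ l"
proof -
  define b where "b = k - k\<^sup>2 / 2"
  have b: "0 \<le> b" using k mult_left_mono[of k 1 k] by (simp add: b_def power2_eq_square)
  have AV: "card A \<le> card V" using V by (simp add: card_mono)
  have "real (card A) * exp (- k) + real (card (V - A)) \<le> real (card A) * (1 - b) + (real (card V) - real (card A))"
    using exp_minus_le_quadratic[OF k(1)] V AV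
    by (intro add_mono mult_left_mono) (auto simp: b_def card_Diff_subset finite_subset)
  also have "\<dots> = real (card V) - b * real (card A)" by (simp add: algebra_simps)
  also have "\<dots> \<le> real (card V) - b * (a * real (card V))" using mult_left_mono[OF a b] by simp
  also have "\<dots> = real (card V) * (1 + (- (a * b)))" by (simp add: algebra_simps)
  also have "\<dots> \<le> real (card V) * exp (- (a * b))"
    using exp_ge_add_one_self[of "- (a * b)"] by (intro mult_left_mono) auto
  finally have "(real (card A) * exp (- k) + real (card (V - A))) ^ l \<le> (real (card V) * exp (- (a * b))) ^ l"
    by (intro power_mono) auto
  also have "\<dots> = real (card V) ^ l * exp (- (a * b * l))"
    by (simp add: power_mult_distrib exp_of_nat_mult[symmetric] mult.commute)
  finally have "exp (k * s) * (real (card A) * exp (- k) + real (card (V - A))) ^ l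
      \<le> exp (k * s) * (real (card V) ^ l * exp (- (a * b * l)))" by simp
  also have "\<dots> = exp (k * s - a * b * l) * real (card V) ^ l" by (simp add: exp_diff exp_minus field_simps)
  finally show ?thesis using card_lists_few_hits[OF V k(1), of l s] unfolding b_def by linarith
qed

section \<open>From independent entries to blocks of a random permutation\<close>

lemma fact_ge_power:
  assumes "m \<le> w"
  shows "(w - m) ^ m * fact (w - m) \<le> (fact w :: nat)"
  using assms
proof (induction m arbitrary: w)
  case (Suc m)
  then obtain w' where w: "w = Suc w'" "m \<le> w'" by (cases w) auto
  have "(w' - m) * (w' - m) ^ m * fact (w' - m) \<le> Suc w' * fact w'"
    using mult_mono[OF _ Suc.IH[OF w(2)], of "w' - m" "Suc w'"] by (simp add: mult.assoc)
  then show ?case using w by simp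
qed simp

text \<open>Compares the \<open>w ^ m\<close> lists with repetition to the
  \<open>fact w / fact (w - m)\<close> injective ones. By Bernoulli, \<open>(1 - m / w) ^ m\<close>
  is at least \<open>1 - m^2 / w\<close>, hence at least 1/2.\<close>

lemma power_fact_le_twice_fact:
  assumes "2 * m\<^sup>2 \<le> w" "0 < m"
  shows "real w ^ m * fact (w - m) \<le> 2 * fact w"
proof -
  have mw: "m \<le> w" using assms by (metis le_trans le_square mult_2 power2_eq_square trans_le_add1)
  have w: "0 < w" using mw assms by simp
  define x where "x = real m / real w"
  have x: "x \<le> 1" "m * x \<le> 1 / 2" using mw w assms(1)
    by (simp_all add: x_def field_simps power2_eq_square) (metis of_nat_le_iff of_nat_mult of_nat_numeral)
  have "1 / 2 \<le> 1 + real m * (- x)" using x by simp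
  also have "\<dots> \<le> (1 - x) ^ m" using Bernoulli_inequality[of "- x" m] x by simp
  finally have "real w ^ m * (1 / 2) \<le> real w ^ m * (1 - x) ^ m" by (intro mult_left_mono) auto
  also have "\<dots> = (real w * (1 - x)) ^ m" by (simp add: power_mult_distrib)
  also have "real w * (1 - x) = real (w - m)" using w mw by (simp add: x_def field_simps)
  finally have "real w ^ m \<le> 2 * real (w - m) ^ m" by simp
  then have "real w ^ m * fact (w - m) \<le> 2 * real (w - m) ^ m * fact (w - m)"
    by (intro mult_right_mono) auto
  also have "\<dots> = 2 * real ((w - m) ^ m * fact (w - m))" by simp
  also have "\<dots> \<le> 2 * real (fact w)" using fact_ge_power[OF mw] by (simp only: of_nat_le_iff mult_le_cancel_left_pos zero_less_numeral)
  finally show ?thesis by simp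
qed

definition list_block :: "nat \<Rightarrow> 'a list \<Rightarrow> nat \<Rightarrow> 'a list" where
  "list_block m xs j = take m (drop (j * m) xs)"

text \<open>Deleting a known block loses nothing: what remains is an arrangement of the other
  \<open>card V - m\<close> elements and determines the permutation.\<close>

lemma card_permutations_block_eq:
  assumes V: "finite V" and m: "Suc j * m \<le> card V"
  shows "card {xs \<in> permutations_of_set V. list_block m xs j = ys} \<le> fact (card V - m)"
proof (cases "{xs \<in> permutations_of_set V. list_block m xs j = ys} = {}")
  case True
  then show ?thesis by (metis card.empty le0)
next
  case False
  define h :: "'a list \<Rightarrow> 'a list" where "h xs = take (j * m) xs @ drop (Suc j * m) xs" for xs
  have split: "xs = take (j * m) xs @ list_block m xs j @ drop (Suc j * m) xs" for xs :: "'a list"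
    unfolding list_block_def
    by (metis append_take_drop_id drop_drop mult_Suc)
  have len: "length (list_block m xs j) = m" "length (take (j * m) xs) = j * m"
    if "xs \<in> permutations_of_set V" for xs
    using that m length_finite_permutations_of_set[of xs V] by (auto simp: list_block_def)
  from False obtain xs0 where xs0: "xs0 \<in> permutations_of_set V" "list_block m xs0 j = ys" by blast
  have ys: "distinct ys" "set ys \<subseteq> V" "length ys = m"
    using xs0 len[OF xs0(1)] set_take_subset[of m "drop (j*m) xs0"] set_drop_subset[of "j*m" xs0]
    by (auto simp: permutations_of_set_def list_block_def)
  have "inj_on h {xs \<in> permutations_of_set V. list_block m xs j = ys}"
  proof (rule inj_onI)
    fix xs zs assume a: "xs \<in> {xs \<in> permutations_of_set V. list_block m xs j = ys}"
      "zs \<in> {xs \<in> permutations_of_set V. list_block m xs j = ys}" "h xs = h zs"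
    then have "take (j * m) xs = take (j * m) zs" "drop (Suc j * m) xs = drop (Suc j * m) zs"
      using len unfolding h_def by (auto simp: append_eq_append_conv)
    then show "xs = zs" using a split[of xs] split[of zs] by auto
  qed
  moreover have "h ` {xs \<in> permutations_of_set V. list_block m xs j = ys} \<subseteq> permutations_of_set (V - set ys)"
  proof clarify
    fix xs assume a: "xs \<in> permutations_of_set V" "ys = list_block m xs j"
    then have "distinct (take (j * m) xs @ list_block m xs j @ drop (Suc j * m) xs)"
      "set (take (j * m) xs @ list_block m xs j @ drop (Suc j * m) xs) = V"
      using split[of xs] by (auto simp: permutations_of_set_def)
    then show "h xs \<in> permutations_of_set (V - set (list_block m xs j))"
      unfolding h_def permutations_of_set_def by auto
  qed
  ultimately have "card {xs \<in> permutations_of_set V. list_block m xs j = ys} \<le> card (permutations_of_set (V - set ys))"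
    by (intro card_inj_on_le) auto
  also have "\<dots> = fact (card V - m)"
    using V ys by (simp add: card_Diff_subset distinct_card)
  finally show ?thesis .
qed

text \<open>First moment method: a fixed \<open>k\<close> is bad for at most
  \<open>card (Bad k) * fact (card V - m)\<close> permutations, which is a share of at most
  \<open>2 * p\<close> of all of them.\<close>

lemma exists_permutation_few_bad_blocks:
  fixes p :: real and Bad :: "'k \<Rightarrow> 'a list set" and j :: "'k \<Rightarrow> nat"
  assumes V: "finite V" and K: "finite K" and m: "0 < m" "2 * m\<^sup>2 \<le> card V"
    and j: "\<And>k. k \<in> K \<Longrightarrow> Suc (j k) * m \<le> card V"
    and fin: "\<And>k. k \<in> K \<Longrightarrow> finite (Bad k)"
    and Bad: "\<And>k. k \<in> K \<Longrightarrow> real (card (Bad k)) \<le> p * real (card V) ^ m"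
  shows "\<exists>xs \<in> permutations_of_set V. real (card {k \<in> K. list_block m xs (j k) \<in> Bad k}) \<le> 2 * p * real (card K)"
proof (rule ccontr)
  define P where "P = permutations_of_set V"
  have P: "finite P" "card P = fact (card V)" using V by (auto simp: P_def)
  assume "\<not> ?thesis"
  then have gt: "\<And>xs. xs \<in> P \<Longrightarrow> real (card {k \<in> K. list_block m xs (j k) \<in> Bad k}) > 2 * p * real (card K)"
    unfolding P_def by fastforce
  have "P \<noteq> {}" using P by (metis card.empty fact_nonzero)
  then have "(\<Sum>xs\<in>P. 2 * p * real (card K)) < (\<Sum>xs\<in>P. real (card {k \<in> K. list_block m xs (j k) \<in> Bad k}))"
    using P gt by (intro sum_strict_mono) auto
  also have "\<dots> = real (\<Sum>xs\<in>P. card {k \<in> K. list_block m xs (j k) \<in> Bad k})" by simp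
  also have "(\<Sum>xs\<in>P. card {k \<in> K. list_block m xs (j k) \<in> Bad k})
      = (\<Sum>k\<in>K. card {xs \<in> P. list_block m xs (j k) \<in> Bad k})"
    using P K by (intro sum_multicount_gen) auto
  also have "real \<dots> = (\<Sum>k\<in>K. real (card {xs \<in> P. list_block m xs (j k) \<in> Bad k}))" by simp
  also have "\<dots> \<le> (\<Sum>k\<in>K. 2 * p * fact (card V))"
  proof (rule sum_mono)
    fix k assume k: "k \<in> K"
    \<comment> \<open>The sign of \<open>p\<close> is not among the assumptions; it follows from the
      bound on \<open>Bad\<close> once some \<open>k\<close> exists.\<close>
    have p: "0 \<le> p * real (card V) ^ m" using Bad[OF k] by (meson of_nat_0_le_iff order_trans)
    have "2 * m\<^sup>2 > 0" using m by simp
    then have "card V > 0" using m by linarith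
    then have p0: "0 \<le> p" using p by (metis of_nat_0_less_iff zero_less_power zero_le_mult_iff linorder_not_le)
    have "{xs \<in> P. list_block m xs (j k) \<in> Bad k} = (\<Union>ys\<in>Bad k. {xs \<in> P. list_block m xs (j k) = ys})" by auto
    then have "card {xs \<in> P. list_block m xs (j k) \<in> Bad k} \<le> (\<Sum>ys\<in>Bad k. card {xs \<in> P. list_block m xs (j k) = ys})"
      using fin[OF k] by (simp add: card_UN_le)
    also have "\<dots> \<le> (\<Sum>ys\<in>Bad k. fact (card V - m))"
      unfolding P_def using V j[OF k] by (intro sum_mono card_permutations_block_eq)
    also have "\<dots> = card (Bad k) * fact (card V - m)" by simp
    finally have "real (card {xs \<in> P. list_block m xs (j k) \<in> Bad k}) \<le> real (card (Bad k)) * fact (card V - m)"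
      by (metis of_nat_fact of_nat_le_iff of_nat_mult)
    also have "\<dots> \<le> p * real (card V) ^ m * fact (card V - m)"
      using Bad[OF k] by (intro mult_right_mono) auto
    also have "\<dots> = p * (real (card V) ^ m * fact (card V - m))" by simp
    also have "\<dots> \<le> p * (2 * fact (card V))"
      using power_fact_le_twice_fact[OF m(2,1)] p0 by (intro mult_left_mono)
    finally show "real (card {xs \<in> P. list_block m xs (j k) \<in> Bad k}) \<le> 2 * p * fact (card V)" by simp
  qed
  finally show False using P by (simp add: algebra_simps)
qed

section \<open>Degrees into a random block\<close>

definition nbh :: "'a set set \<Rightarrow> 'a \<Rightarrow> 'a set" where
  "nbh E v = {u. {u, v} \<in> E}"

text \<open>The vertex \<open>v\<close> may lie outside \<open>U\<close>. Testing it together with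
  all of \<open>U\<close> lets a single count of triples control both the blocks that are poor in
  themselves and the vertices unsuitable for joining a block.\<close>

definition deficient :: "'a set set \<Rightarrow> real \<Rightarrow> 'a set \<Rightarrow> 'a \<Rightarrow> bool" where
  "deficient E s U v \<longleftrightarrow> (\<exists>u\<in>insert v U. real (card (nbh E u \<inter> U)) < s)"

text \<open>The gap \<open>k\<close> between the density \<open>c + 3 * k\<close> and the demanded
  \<open>c + 2 * k\<close> also serves as parameter of the exponential moment. One term of the bound
  comes from \<open>v\<close>, the other \<open>m\<close> from the entries of the list, whose test
  sets depend on the list itself.\<close>

lemma card_deficient_lists:
  fixes c k :: real
  assumes V: "finite V" and k: "0 < k" "k \<le> 1" and c: "0 \<le> c" "c + 3 * k \<le> 1" and m: "0 < m"
    and nb: "\<And>v. v \<in> V \<Longrightarrow> nbh E v \<subseteq> V"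
    and deg: "\<And>v. v \<in> V \<Longrightarrow> (c + 3 * k) * card V \<le> card (nbh E v)"
    and v: "v \<in> V"
  shows "real (card {xs. set xs \<subseteq> V \<and> length xs = m \<and>
      (\<exists>u\<in>insert v (set xs). real (length (filter (\<lambda>x. x \<in> nbh E u) xs)) < (c + 2 * k) * m)})
    \<le> (real m * exp 1 + 1) * exp (- (k\<^sup>2 * m / 2)) * real (card V) ^ m"
proof -
  define s where "s = (c + 2 * k) * m"
  define L where "L l u = {xs. set xs \<subseteq> V \<and> length xs = l \<and> real (length (filter (\<lambda>x. x \<in> nbh E u) xs)) < s}"
    for l u
  define M where "M p = {xs. set xs \<subseteq> V \<and> length xs = m \<and> real (length (filter (\<lambda>x. x \<in> nbh E (xs ! p)) xs)) < s}"
    for p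
  define e where "e = exp (- (k\<^sup>2 * m / 2))"
  have finL: "finite (L l u)" for l u unfolding L_def using finite_lists_length[OF V] .
  have finM: "finite (M p)" for p unfolding M_def using finite_lists_length[OF V] .
  have expo: "k * s - (c + 3 * k) * (k - k\<^sup>2 / 2) * m \<le> - (k\<^sup>2 * m / 2)"
  proof -
    have "k * s - (c + 3 * k) * (k - k\<^sup>2 / 2) * m = - (k\<^sup>2 * m) + (c + 3 * k) * (k\<^sup>2 * m / 2)"
      by (simp add: s_def algebra_simps power2_eq_square)
    also have "\<dots> \<le> - (k\<^sup>2 * m) + 1 * (k\<^sup>2 * m / 2)" using c by (intro add_left_mono mult_right_mono) auto
    finally show ?thesis by (simp add: mult.commute)
  qed
  have L1: "real (card (L m u)) \<le> e * real (card V) ^ m" if "u \<in> V" for u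
  proof -
    have "real (card (L m u)) \<le> exp (k * s - (c + 3 * k) * (k - k\<^sup>2 / 2) * m) * real (card V) ^ m"
      unfolding L_def using V nb that deg k by (intro card_lists_few_hits_dense) auto
    also have "\<dots> \<le> e * real (card V) ^ m" unfolding e_def using expo by (intro mult_right_mono) auto
    finally show ?thesis .
  qed
  \<comment> \<open>With one entry removed, the threshold \<open>s\<close> still refers to length
    \<open>m\<close>; the decay lost by this is at most a factor \<open>exp 1\<close>.\<close>
  have L2: "real (card (L (m - 1) u)) \<le> exp 1 * e * real (card V) ^ (m - 1)" if "u \<in> V" for u
  proof -
    have "real (card (L (m - 1) u)) \<le> exp (k * s - (c + 3 * k) * (k - k\<^sup>2 / 2) * real (m - 1)) * real (card V) ^ (m - 1)"
      unfolding L_def using V nb that deg k by (intro card_lists_few_hits_dense) auto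
    also have "\<dots> \<le> exp 1 * e * real (card V) ^ (m - 1)"
    proof (rule mult_right_mono)
      have "k - k\<^sup>2 / 2 \<le> 1" using k by (smt (verit) zero_le_power2 divide_nonneg_nonneg)
      moreover have "0 \<le> k - k\<^sup>2 / 2" using k mult_left_mono[of k 1 k] by (simp add: power2_eq_square)
      ultimately have "(c + 3 * k) * (k - k\<^sup>2 / 2) \<le> 1 * 1" using c by (intro mult_mono) auto
      moreover have "k * s - (c + 3 * k) * (k - k\<^sup>2 / 2) * real (m - 1)
        = (k * s - (c + 3 * k) * (k - k\<^sup>2 / 2) * m) + (c + 3 * k) * (k - k\<^sup>2 / 2)"
        
      proof -
        have "real (m - 1) = real m - 1" using m by (simp add: of_nat_diff)
        then show ?thesis by (simp only: right_diff_distrib) simp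
      qed
      ultimately have "k * s - (c + 3 * k) * (k - k\<^sup>2 / 2) * real (m - 1) \<le> 1 + - (k\<^sup>2 * m / 2)"
        using expo by linarith
      then show "exp (k * s - (c + 3 * k) * (k - k\<^sup>2 / 2) * real (m - 1)) \<le> exp 1 * e"
        unfolding e_def exp_add[symmetric] by simp
    qed simp
    finally show ?thesis .
  qed
  \<comment> \<open>To make the test set independent of the list, take out the entry
    \<open>xs ! p\<close>: the others form a list of length \<open>m - 1\<close> with no more
    hits.\<close>
  have M1: "real (card (M p)) \<le> exp 1 * e * real (card V) ^ m" if p: "p < m" for p
  proof -
    let ?h = "\<lambda>xs. (xs ! p, take p xs @ drop (Suc p) xs)"
    have "inj_on ?h (M p)"
    proof (rule inj_onI)
      fix xs ys assume a: "xs \<in> M p" "ys \<in> M p" "?h xs = ?h ys"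
      have "length xs = m" "length ys = m" using a by (auto simp: M_def)
      then have "xs = take p xs @ xs ! p # drop (Suc p) xs" "ys = take p ys @ ys ! p # drop (Suc p) ys"
        "length (take p xs) = length (take p ys)"
        using p by (auto intro: id_take_nth_drop)
      then show "xs = ys" using a(3) by (metis append_eq_append_conv prod.inject)
    qed
    moreover have "?h ` M p \<subseteq> (SIGMA u:V. L (m - 1) u)"
    proof clarify
      fix xs assume a: "xs \<in> M p"
      then have len: "length xs = m" and sub: "set xs \<subseteq> V"
        and cnt: "real (length (filter (\<lambda>x. x \<in> nbh E (xs ! p)) xs)) < s" by (auto simp: M_def)
      have xs: "xs = take p xs @ xs ! p # drop (Suc p) xs" using p len by (intro id_take_nth_drop) simp
      have "length (filter (\<lambda>x. x \<in> nbh E (xs ! p)) (take p xs @ drop (Suc p) xs))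
        \<le> length (filter (\<lambda>x. x \<in> nbh E (xs ! p)) xs)"
        using arg_cong[OF xs, of "\<lambda>ys. length (filter (\<lambda>x. x \<in> nbh E (xs ! p)) ys)"] by simp
      moreover have "set (take p xs @ drop (Suc p) xs) \<subseteq> V"
        using sub set_take_subset[of p xs] set_drop_subset[of "Suc p" xs] by auto
      moreover have "xs ! p \<in> V" using sub p len by auto
      ultimately show "(xs ! p \<in> V) \<and> take p xs @ drop (Suc p) xs \<in> L (m - 1) (xs ! p)"
        using cnt len p by (auto simp: L_def)
    qed
    ultimately have "card (M p) \<le> card (SIGMA u:V. L (m - 1) u)"
      using V finL by (intro card_inj_on_le) auto
    then have "real (card (M p)) \<le> (\<Sum>u\<in>V. real (card (L (m - 1) u)))"
      using V finL by (simp add: card_SigmaI flip: of_nat_sum)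
    also have "\<dots> \<le> (\<Sum>u\<in>V. exp 1 * e * real (card V) ^ (m - 1))" by (rule sum_mono) (rule L2)
    also have "\<dots> = exp 1 * e * real (card V) ^ m" using m by (cases m) auto
    finally show ?thesis .
  qed
  have "{xs. set xs \<subseteq> V \<and> length xs = m \<and>
      (\<exists>u\<in>insert v (set xs). real (length (filter (\<lambda>x. x \<in> nbh E u) xs)) < s)} \<subseteq> L m v \<union> (\<Union>p<m. M p)"
    by (auto simp: L_def M_def in_set_conv_nth)
  then have "card {xs. set xs \<subseteq> V \<and> length xs = m \<and>
      (\<exists>u\<in>insert v (set xs). real (length (filter (\<lambda>x. x \<in> nbh E u) xs)) < s)} \<le> card (L m v \<union> (\<Union>p<m. M p))"
    using finL finM by (intro card_mono) auto
  also have "\<dots> \<le> card (L m v) + card (\<Union>p<m. M p)" by (rule card_Un_le)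
  also have "card (\<Union>p<m. M p) \<le> (\<Sum>p<m. card (M p))" by (rule card_UN_le) simp
  finally have "real (card {xs. set xs \<subseteq> V \<and> length xs = m \<and>
      (\<exists>u\<in>insert v (set xs). real (length (filter (\<lambda>x. x \<in> nbh E u) xs)) < s)})
    \<le> real (card (L m v) + (\<Sum>p<m. card (M p)))" by (simp only: of_nat_le_iff)
  also have "\<dots> = real (card (L m v)) + (\<Sum>p<m. real (card (M p)))" by simp
  also have "\<dots> \<le> e * real (card V) ^ m + (\<Sum>p<m. exp 1 * e * real (card V) ^ m)"
    using L1[OF v] M1 by (intro add_mono sum_mono) auto
  also have "\<dots> = (real m * exp 1 + 1) * e * real (card V) ^ m" by (simp add: algebra_simps)
  finally show ?thesis unfolding s_def e_def .
qed

text \<open>The first moment bound is applied with one index per triple of colour, block and vertex.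
  Consecutive pieces of one permutation are disjoint automatically, which independently drawn blocks
  would not be.\<close>

lemma exists_blocks_few_deficient:
  fixes c k \<theta> :: real and E :: "nat \<Rightarrow> 'a set set"
  assumes V: "finite V" and k: "0 < k" "k \<le> 1" and c: "0 \<le> c" "c + 3 * k \<le> 1"
    and m: "0 < m" "2 * m\<^sup>2 \<le> card V" "N * m \<le> card V"
    and nb: "\<And>i v. i < n \<Longrightarrow> v \<in> V \<Longrightarrow> nbh (E i) v \<subseteq> V"
    and deg: "\<And>i v. i < n \<Longrightarrow> v \<in> V \<Longrightarrow> (c + 3 * k) * card V \<le> card (nbh (E i) v)"
    and \<theta>: "2 * (real m * exp 1 + 1) * exp (- (k\<^sup>2 * m / 2)) \<le> \<theta>"
  shows "\<exists>U. (\<forall>j<N. U j \<subseteq> V \<and> card (U j) = m) \<and> disjoint_family_on U {..<N} \<and>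
    real (card {(i, j, v) \<in> {..<n} \<times> {..<N} \<times> V. deficient (E i) ((c + 2 * k) * m) (U j) v})
      \<le> \<theta> * (real n * real N * real (card V))"
proof -
  define s where "s = (c + 2 * k) * m"
  define K where "K = {..<n} \<times> {..<N} \<times> V"
  define j where "j = (\<lambda>(i :: nat, j :: nat, v :: 'a). j)"
  define Bad where "Bad = (\<lambda>(i, j :: nat, v). {xs. set xs \<subseteq> V \<and> length xs = m \<and>
      (\<exists>u\<in>insert v (set xs). real (length (filter (\<lambda>x. x \<in> nbh (E i) u) xs)) < s)})"
  define p where "p = (real m * exp 1 + 1) * exp (- (k\<^sup>2 * m / 2))"
  have jm: "Suc j * m \<le> card V" if "j < N" for j
    using that m(3) by (meson Suc_leI le_trans mult_le_mono1)
  have "\<exists>xs\<in>permutations_of_set V. real (card {x \<in> K. list_block m xs (j x) \<in> Bad x}) \<le> 2 * p * real (card K)"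
  proof (rule exists_permutation_few_bad_blocks[OF V _ m(1,2)])
    show "finite K" using V by (simp add: K_def)
    fix x assume x: "x \<in> K"
    then show "Suc (j x) * m \<le> card V" using jm by (auto simp: K_def j_def)
    show "finite (Bad x)" unfolding Bad_def using finite_lists_length[OF V] by (auto split: prod.split)
    show "real (card (Bad x)) \<le> p * real (card V) ^ m"
      using x card_deficient_lists[OF V k c m(1)] nb deg unfolding Bad_def p_def s_def K_def by auto
  qed
  then obtain xs where xs: "xs \<in> permutations_of_set V"
    and few: "real (card {x \<in> K. list_block m xs (j x) \<in> Bad x}) \<le> 2 * p * real (card K)" by blast
  have dist: "distinct xs" and set_xs: "set xs = V" and len: "length xs = card V"
    using xs by (auto simp: permutations_of_set_def distinct_card)
  define U where "U j = set (list_block m xs j)" for j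
  have nthU: "U j = (\<lambda>p. xs ! p) ` {j * m..<Suc j * m}" if "j < N" for j
  proof -
    have "list_block m xs j = map (\<lambda>p. xs ! p) [j * m..<Suc j * m]"
      unfolding list_block_def using jm[OF that] len by (intro nth_equalityI) auto
    then show ?thesis by (simp add: U_def)
  qed
  have db: "distinct (list_block m xs j)" for j using dist by (simp add: list_block_def)
  have subV: "set (list_block m xs j) \<subseteq> V" for j
    using set_xs set_take_subset[of m "drop (j * m) xs"] set_drop_subset[of "j * m" xs]
    unfolding list_block_def by blast
  have lenb: "length (list_block m xs j) = m" if "j < N" for j
    using jm[OF that] len by (simp add: list_block_def)
  have U1: "U j \<subseteq> V \<and> card (U j) = m" if "j < N" for j
    using subV lenb[OF that] db by (simp add: U_def distinct_card)
  have U2: "disjoint_family_on U {..<N}"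
    unfolding disjoint_family_on_def
  proof (intro ballI impI)
    fix a b assume ab: "a \<in> {..<N}" "b \<in> {..<N}" "a \<noteq> b"
    show "U a \<inter> U b = {}"
    proof (rule ccontr)
      assume "U a \<inter> U b \<noteq> {}"
      then obtain p q where pq: "p \<in> {a * m..<Suc a * m}" "q \<in> {b * m..<Suc b * m}" "xs ! p = xs ! q"
        using nthU ab by fastforce
      moreover have "p < length xs" "q < length xs" using pq jm[of a] jm[of b] ab len by auto
      ultimately have "p = q" using dist by (simp add: nth_eq_iff_index_eq)
      moreover have "p div m = a" "q div m = b" using pq by (auto intro!: div_nat_eqI simp: algebra_simps)
      ultimately show False using ab by simp
    qed
  qed
  have "{(i, j, v) \<in> K. deficient (E i) s (U j) v} \<subseteq> {x \<in> K. list_block m xs (j x) \<in> Bad x}"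
  proof clarify
    fix i ja v assume a: "(i, ja, v) \<in> K" "deficient (E i) s (U ja) v"
    have "card (nbh (E i) u \<inter> U ja) = length (filter (\<lambda>x. x \<in> nbh (E i) u) (list_block m xs ja))" for u
    proof -
      have "nbh (E i) u \<inter> U ja = set (filter (\<lambda>x. x \<in> nbh (E i) u) (list_block m xs ja))" by (auto simp: U_def)
      then show ?thesis using db by (simp only: distinct_card distinct_filter)
    qed
    then show "list_block m xs (j (i, ja, v)) \<in> Bad (i, ja, v)"
      using a subV lenb unfolding deficient_def j_def Bad_def U_def K_def by auto
  qed
  then have "real (card {(i, j, v) \<in> K. deficient (E i) s (U j) v}) \<le> real (card {x \<in> K. list_block m xs (j x) \<in> Bad x})"
    using V by (intro of_nat_mono card_mono) (auto simp: K_def)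
  then have "real (card {(i, j, v) \<in> K. deficient (E i) s (U j) v}) \<le> 2 * p * real (card K)" using few by linarith
  also have "\<dots> = (2 * p) * (real n * real N * real (card V))" by (simp add: K_def card_cartesian_product)
  also have "2 * p \<le> \<theta>" using \<theta> by (simp only: p_def mult.assoc)
  then have "(2 * p) * (real n * real N * real (card V)) \<le> \<theta> * (real n * real N * real (card V))"
    by (intro mult_right_mono) simp_all
  finally show ?thesis using U1 U2 unfolding s_def K_def by blast
qed

section \<open>Greedy choices and matchings\<close>

lemma pigeonhole_fibre:
  assumes "finite X" "finite Y" "f ` X \<subseteq> Y" "card Y * k < card X"
  shows "\<exists>D\<subseteq>X. card D = k \<and> (\<forall>x\<in>D. \<forall>y\<in>D. f x = f y)"
proof (rule ccontr)
  assume neg: "\<not> ?thesis"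
  have fib: "card {x \<in> X. f x = y} \<le> k" for y
  proof (rule ccontr)
    assume "\<not> card {x \<in> X. f x = y} \<le> k"
    then have "k \<le> card {x \<in> X. f x = y}" by simp
    then obtain D where "D \<subseteq> {x \<in> X. f x = y}" "card D = k"
      by (metis obtain_subset_with_card_n)
    then have "D \<subseteq> X" "\<forall>x\<in>D. \<forall>y\<in>D. f x = f y" by auto
    with neg \<open>card D = k\<close> show False by blast
  qed
  have "X = (\<Union>y\<in>Y. {x \<in> X. f x = y})" using assms(3) by auto
  then have "card X \<le> (\<Sum>y\<in>Y. card {x \<in> X. f x = y})" using card_UN_le[OF assms(2)] by metis
  also have "\<dots> \<le> (\<Sum>y\<in>Y. k)" by (rule sum_mono[OF fib])
  finally show False using assms(4) by simp
qed

lemma greedy_injection: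
  assumes "finite X" "\<And>x. x \<in> X \<Longrightarrow> card X \<le> card (A x)"
  shows "\<exists>g. inj_on g X \<and> (\<forall>x\<in>X. g x \<in> A x)"
proof -
  have "\<exists>g. inj_on g X' \<and> (\<forall>x\<in>X'. g x \<in> A x)" if "X' \<subseteq> X" for X'
    using finite_subset[OF that assms(1)] that
  proof (induction X' rule: finite_induct)
    case (insert x X')
    then obtain g where g: "inj_on g X'" "\<forall>x\<in>X'. g x \<in> A x" by auto
    have "card (g ` X') < card X"
    proof -
      have "card (g ` X') \<le> card X'" using insert by (simp add: card_image_le)
      also have "\<dots> < card X" using insert assms(1) by (intro psubset_card_mono) auto
      finally show ?thesis .
    qed
    also have "\<dots> \<le> card (A x)" using insert assms(2) by simp
    finally have "\<not> A x \<subseteq> g ` X'" using insert by (metis card_mono finite_imageI leD)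
    then obtain a where "a \<in> A x" "a \<notin> g ` X'" by blast
    then have "inj_on (g(x := a)) (insert x X') \<and> (\<forall>y\<in>insert x X'. (g(x := a)) y \<in> A y)"
      using g insert.hyps by (auto simp: inj_on_def)
    then show ?case by blast
  qed simp
  then show ?thesis by blast
qed

text \<open>A bijection with the most pairs in \<open>R\<close> cannot leave a pair outside \<open>R\<close>: by the degree
  conditions some other pair could be exchanged with it.\<close>

lemma bij_betw_of_few_nonneighbours:
  assumes X: "finite X" "finite Y" "card X = card Y"
    and l: "\<And>x. x \<in> X \<Longrightarrow> 2 * card {y \<in> Y. \<not> R x y} < card X"
    and r: "\<And>y. y \<in> Y \<Longrightarrow> 2 * card {x \<in> X. \<not> R x y} < card X"
  shows "\<exists>h. bij_betw h X Y \<and> (\<forall>x\<in>X. R x (h x))"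
proof -
  define w where "w h = card {x \<in> X. \<not> R x (h x)}" for h
  obtain h0 where "bij_betw h0 X Y" using X finite_same_card_bij by blast
  then obtain h where h: "bij_betw h X Y" and hmin: "\<And>h'. bij_betw h' X Y \<Longrightarrow> w h \<le> w h'"
    using ex_has_least_nat[of "\<lambda>h. bij_betw h X Y" h0 w] by blast
  have "R x (h x)" if x: "x \<in> X" for x
  proof (rule ccontr)
    assume nR: "\<not> R x (h x)"
    have inj: "inj_on h X" and im: "h ` X = Y" using h by (auto simp: bij_betw_def)
    \<comment> \<open>\<open>?P\<close> holds the elements whose image \<open>x\<close> cannot take,
      \<open>?Q\<close> those that cannot take \<open>h x\<close>. Both contain \<open>x\<close>, so
      any \<open>z\<close> outside them differs from \<open>x\<close>.\<close>
    let ?P = "{z \<in> X. \<not> R x (h z)}" and ?Q = "{z \<in> X. \<not> R z (h x)}"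
    have "h ` ?P \<subseteq> {y \<in> Y. \<not> R x y}" using im by auto
    then have "card ?P \<le> card {y \<in> Y. \<not> R x y}"
      using X inj by (intro card_inj_on_le[of h]) (auto simp: inj_on_def)
    then have "2 * card ?P < card X" using l[OF x] by simp
    moreover have "2 * card ?Q < card X" using r[of "h x"] x im by auto
    moreover have "card (?P \<union> ?Q) \<le> card ?P + card ?Q" by (rule card_Un_le)
    ultimately have "card (?P \<union> ?Q) < card X" by linarith
    then have "\<not> X \<subseteq> ?P \<union> ?Q" 
      using X(1) card_mono[of "?P \<union> ?Q" X] by auto
    then obtain z where z: "z \<in> X" "R x (h z)" "R z (h x)" by blast
    define h' where "h' = h \<circ> transpose x z"
    have h'x: "h' x = h z" "h' z = h x" "\<And>u. u \<noteq> x \<Longrightarrow> u \<noteq> z \<Longrightarrow> h' u = h u"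
      by (auto simp: h'_def transpose_def)
    have "bij_betw h' X Y"
      unfolding h'_def using x z h by (simp add: bij_betw_swap_iff)
    \<comment> \<open>Only \<open>x\<close> and \<open>z\<close> change their partners, and both end
      up with one allowed by \<open>R\<close>.\<close>
    have "{u \<in> X. \<not> R u (h' u)} \<subset> {u \<in> X. \<not> R u (h u)}"
      
    proof
      show "{u \<in> X. \<not> R u (h' u)} \<subseteq> {u \<in> X. \<not> R u (h u)}" using z h'x by (metis (mono_tags, lifting) Collect_mono)
      show "{u \<in> X. \<not> R u (h' u)} \<noteq> {u \<in> X. \<not> R u (h u)}" 
      proof -
        have "x \<in> {u \<in> X. \<not> R u (h u)}" "x \<notin> {u \<in> X. \<not> R u (h' u)}" using x z nR h'x(1) by auto
        then show ?thesis by metis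
      qed
    qed
    then have "w h' < w h" unfolding w_def using X by (intro psubset_card_mono) auto
    then show False using hmin[OF \<open>bij_betw h' X Y\<close>] by simp
  qed
  then show ?thesis using h by blast
qed

lemma split_into_equal_sets:
  assumes "finite W" "card W = s * r" "0 < r"
  shows "\<exists>\<Q>. finite \<Q> \<and> card \<Q> = s \<and> disjoint \<Q> \<and> \<Union>\<Q> = W \<and> (\<forall>Q\<in>\<Q>. card Q = r)"
  using assms
proof (induction s arbitrary: W)
  case 0
  then show ?case by (intro exI[of _ "{}"]) auto
next
  case (Suc s)
  obtain Q where Q: "Q \<subseteq> W" "card Q = r" using Suc.prems by (metis le_add1 mult_Suc obtain_subset_with_card_n)
  have fQ: "finite Q" using Q Suc.prems finite_subset by blast
  have "card (W - Q) = s * r" using Suc.prems Q fQ by (simp add: card_Diff_subset)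
  then obtain \<Q> where \<Q>: "finite \<Q>" "card \<Q> = s" "disjoint \<Q>" "\<Union>\<Q> = W - Q" "\<forall>Q\<in>\<Q>. card Q = r"
    using Suc.IH[of "W - Q"] Suc.prems by auto
  have "Q \<notin> \<Q>" 
  proof
    assume "Q \<in> \<Q>"
    then have "Q \<subseteq> W - Q" using \<Q>(4) by blast
    then have "Q = {}" by blast
    then show False using Q(2) Suc.prems(3) by simp
  qed
  moreover have "disjoint (insert Q \<Q>)" using \<Q> by (auto simp: disjoint_def)
  ultimately show ?case using \<Q> Q by (intro exI[of _ "insert Q \<Q>"]) auto
qed

text \<open>The surplus \<open>t\<close> is a reserve: before each choice at least \<open>t\<close>
  elements of \<open>C\<close> are untouched, so it suffices that a choice is possible inside every
  subset of that size.\<close>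

lemma greedy_disjoint_subsets:
  fixes d :: "'b \<Rightarrow> nat"
  assumes "finite B" "finite C" "sum d B + t \<le> card C"
    and "\<And>b R. b \<in> B \<Longrightarrow> R \<subseteq> C \<Longrightarrow> t \<le> card R \<Longrightarrow> \<exists>D\<subseteq>R. card D = d b \<and> P b D"
  shows "\<exists>D. (\<forall>b\<in>B. D b \<subseteq> C \<and> card (D b) = d b \<and> P b (D b)) \<and> disjoint_family_on D B"
  using assms
proof (induction B rule: finite_induct)
  case empty
  then show ?case by (auto simp: disjoint_family_on_def)
next
  case (insert b B)
  then obtain D where D: "\<forall>b\<in>B. D b \<subseteq> C \<and> card (D b) = d b \<and> P b (D b)" "disjoint_family_on D B"
    by (auto simp: sum.insert)
  let ?R = "C - (\<Union>b\<in>B. D b)"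
  have "card (\<Union>b\<in>B. D b) \<le> (\<Sum>b\<in>B. card (D b))" by (rule card_UN_le[OF insert.hyps(1)])
  also have "\<dots> = sum d B" using D by simp
  finally have "card C - card (\<Union>b\<in>B. D b) \<ge> t" using insert by simp
  moreover have "card C - card (\<Union>b\<in>B. D b) \<le> card ?R"
    using insert.prems(1) D by (intro diff_card_le_card_Diff) (auto intro: finite_subset)
  ultimately obtain S where S: "S \<subseteq> ?R" "card S = d b" "P b S"
    using insert.prems(3)[of b ?R] by auto
  have "(\<forall>b'\<in>insert b B. (D(b := S)) b' \<subseteq> C \<and> card ((D(b := S)) b') = d b' \<and> P b' ((D(b := S)) b'))"
    using S D by auto
  moreover have "disjoint_family_on (D(b := S)) (insert b B)"
    using S D insert.hyps by (auto simp: disjoint_family_on_def)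
  ultimately show ?case by blast
qed

section \<open>Averaging: from few bad triples to few exceptional colours, blocks and
  vertices\<close>

lemma card_bad_bound:
  fixes x y :: real
  assumes "finite A" "\<And>a. a \<in> A \<Longrightarrow> finite (B a)" "\<And>a. a \<in> A \<Longrightarrow> y \<le> real (card (B a))"
    and "0 < y" "real (card (Sigma A B)) \<le> x * y"
  shows "real (card A) \<le> x"
proof -
  have "real (card A) * y = (\<Sum>a\<in>A. y)" by simp
  also have "\<dots> \<le> (\<Sum>a\<in>A. real (card (B a)))" by (rule sum_mono) (rule assms(3))
  also have "\<dots> = real (card (Sigma A B))" using assms by simp
  also have "\<dots> \<le> x * y" by fact
  finally show ?thesis using assms(4) by simp
qed

text \<open>An exceptional colour or block accounts for a share \<eta> of its triples, since a pair
  in \<open>P\<close> spoils every \<open>v\<close>. An exceptional vertex accounts only for a share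
  \<open>\<eta>^2\<close>, one factor from its blocks and one from their colours; hence the cube in
  the hypothesis.\<close>

lemma exceptional_sets_small:
  fixes \<eta> :: real and n N :: nat and P :: "nat \<Rightarrow> nat \<Rightarrow> bool" and R :: "nat \<Rightarrow> nat \<Rightarrow> 'a \<Rightarrow> bool"
  assumes V: "finite V" "V \<noteq> {}" and pos: "0 < n" "0 < N" "0 < \<eta>" "\<eta> \<le> 1"
    and PR: "\<And>i j v. P i j \<Longrightarrow> R i j v"
    and few: "real (card {(i, j, v) \<in> {..<n} \<times> {..<N} \<times> V. R i j v}) \<le> \<eta> ^ 3 * (real n * real N * real (card V))"
  shows "real (card {i. i < n \<and> \<eta> * N < card {j. j < N \<and> P i j}}) \<le> \<eta> * n"
    and "real (card {j. j < N \<and> \<eta> * n < card {i. i < n \<and> P i j}}) \<le> \<eta> * N"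
    and "real (card {v \<in> V. \<eta> * N < card {j. j < N \<and> \<eta> * n < card {i. i < n \<and> R i j v}}}) \<le> \<eta> * card V"
proof -
  define w where "w = real (card V)"
  define B where "B = {(i, j, v) \<in> {..<n} \<times> {..<N} \<times> V. R i j v}"
  have w: "0 < w" using V by (auto simp: w_def card_gt_0_iff)
  have fB: "finite B" by (rule finite_subset[of _ "{..<n} \<times> {..<N} \<times> V"]) (use V in \<open>auto simp: B_def\<close>)
  have fewB: "real (card B) \<le> \<eta> ^ 3 * (real n * real N * w)" using few by (simp add: B_def w_def)
  have "\<eta> ^ 3 * (real n * real N * w) \<le> \<eta>\<^sup>2 * (real n * real N * w)"
    using pos w by (intro mult_right_mono) (auto intro: power_decreasing)
  then have fewB2: "real (card B) \<le> \<eta>\<^sup>2 * (real n * real N * w)" using fewB by linarith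
  show "real (card {i. i < n \<and> \<eta> * N < card {j. j < N \<and> P i j}}) \<le> \<eta> * n" (is "real (card ?A) \<le> _")
  proof (rule card_bad_bound[where B = "\<lambda>i. {j. j < N \<and> P i j} \<times> V" and y = "\<eta> * N * w"])
    have "Sigma ?A (\<lambda>i. {j. j < N \<and> P i j} \<times> V) \<subseteq> B" using PR by (auto simp: B_def)
    then have "card (Sigma ?A (\<lambda>i. {j. j < N \<and> P i j} \<times> V)) \<le> card B" using fB by (rule card_mono[rotated])
    moreover have "\<eta>\<^sup>2 * (real n * real N * w) = \<eta> * n * (\<eta> * N * w)" by (simp add: power2_eq_square)
    ultimately show "real (card (Sigma ?A (\<lambda>i. {j. j < N \<and> P i j} \<times> V))) \<le> \<eta> * n * (\<eta> * N * w)"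
      using fewB2 by linarith
    fix i assume "i \<in> ?A"
    then have "\<eta> * N * w \<le> card {j. j < N \<and> P i j} * w" using w by (intro mult_right_mono) auto
    then show "\<eta> * N * w \<le> card ({j. j < N \<and> P i j} \<times> V)" by (simp add: card_cartesian_product w_def)
  qed (use pos w V in auto)
  show "real (card {j. j < N \<and> \<eta> * n < card {i. i < n \<and> P i j}}) \<le> \<eta> * N" (is "real (card ?A) \<le> _")
  proof (rule card_bad_bound[where B = "\<lambda>j. {i. i < n \<and> P i j} \<times> V" and y = "\<eta> * n * w"])
    have "card (Sigma ?A (\<lambda>j. {i. i < n \<and> P i j} \<times> V)) \<le> card B"
      using PR by (intro card_inj_on_le[OF _ _ fB, of "\<lambda>(j, i, v). (i, j, v)"]) (auto simp: B_def inj_on_def)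
    moreover have "\<eta>\<^sup>2 * (real n * real N * w) = \<eta> * N * (\<eta> * n * w)" by (simp add: power2_eq_square)
    ultimately show "real (card (Sigma ?A (\<lambda>j. {i. i < n \<and> P i j} \<times> V))) \<le> \<eta> * N * (\<eta> * n * w)"
      using fewB2 by linarith
    fix j assume "j \<in> ?A"
    then have "\<eta> * n * w \<le> card {i. i < n \<and> P i j} * w" using w by (intro mult_right_mono) auto
    then show "\<eta> * n * w \<le> card ({i. i < n \<and> P i j} \<times> V)" by (simp add: card_cartesian_product w_def)
  qed (use pos w V in auto)
  show "real (card {v \<in> V. \<eta> * N < card {j. j < N \<and> \<eta> * n < card {i. i < n \<and> R i j v}}}) \<le> \<eta> * card V"
    (is "real (card ?A) \<le> _")
  proof (rule card_bad_bound[where B = "\<lambda>v. SIGMA j:{j. j < N \<and> \<eta> * n < card {i. i < n \<and> R i j v}}. {i. i < n \<and> R i j v}"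
        and y = "\<eta> * N * (\<eta> * n)"])
    let ?S = "Sigma ?A (\<lambda>v. SIGMA j:{j. j < N \<and> \<eta> * n < card {i. i < n \<and> R i j v}}. {i. i < n \<and> R i j v})"
    have "card ?S \<le> card B"
      by (intro card_inj_on_le[OF _ _ fB, of "\<lambda>(v, j, i). (i, j, v)"]) (auto simp: B_def inj_on_def)
    moreover have "\<eta> ^ 3 * (real n * real N * w) = \<eta> * card V * (\<eta> * N * (\<eta> * n))"
      by (simp add: power3_eq_cube w_def)
    ultimately show "real (card ?S) \<le> \<eta> * card V * (\<eta> * N * (\<eta> * n))" using fewB by linarith
    fix v assume v: "v \<in> ?A"
    let ?J = "{j. j < N \<and> \<eta> * n < card {i. i < n \<and> R i j v}}"
    have "\<eta> * N * (\<eta> * n) \<le> card ?J * (\<eta> * n)" using v pos by (intro mult_right_mono) auto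
    also have "\<dots> = (\<Sum>j\<in>?J. \<eta> * n)" by simp
    also have "\<dots> \<le> (\<Sum>j\<in>?J. real (card {i. i < n \<and> R i j v}))" by (rule sum_mono) auto
    also have "\<dots> = real (card (SIGMA j:?J. {i. i < n \<and> R i j v}))" by (subst card_SigmaI) auto
    finally show "\<eta> * N * (\<eta> * n) \<le> card (SIGMA j:?J. {i. i < n \<and> R i j v})" .
  qed (use pos w V in auto)
qed

section \<open>Assembling the copies\<close>

text \<open>For \<open>\<eta> = 1 / (100 r^2 T^2)\<close> this says that deficient triples have
  density at most \<open>\<eta>^3\<close>: exponential decay in \<open>T\<close> beats a fixed power
  of \<open>T\<close>.\<close>

lemma eventually_exp_dominates:
  fixes k r :: real
  assumes "0 < k" "0 < r"
  shows "eventually (\<lambda>T :: nat. 2 * (r * T * exp 1 + 1) * exp (- (k\<^sup>2 * (r * T) / 2)) * (100 * r\<^sup>2 * (real T)\<^sup>2) ^ 3 \<le> 1) at_top"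
proof -
  define b where "b = k\<^sup>2 * r / 2"
  define a where "a = r * exp 1"
  define d where "d = 100 * r\<^sup>2"
  have pos: "0 < b" "0 < a" "0 < d" using assms by (auto simp: b_def a_def d_def)
  have "((\<lambda>x :: real. 2 * (a * x + 1) * exp (- (b * x)) * (d * x\<^sup>2) ^ 3) \<longlongrightarrow> 0) at_top"
    using pos by real_asymp
  then have "eventually (\<lambda>x :: real. 2 * (a * x + 1) * exp (- (b * x)) * (d * x\<^sup>2) ^ 3 < 1) at_top"
    by (rule order_tendstoD) simp
  then have "eventually (\<lambda>T :: nat. 2 * (a * real T + 1) * exp (- (b * real T)) * (d * (real T)\<^sup>2) ^ 3 < 1) at_top"
    by (rule eventually_compose_filterlim[OF _ filterlim_real_sequentially])
  then show ?thesis by eventually_elim (simp add: a_def b_def d_def mult_ac)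
qed

text \<open>\<open>cp E S\<close> abstracts the existence of a copy of \<open>F\<close> with vertex set \<open>S\<close> and edges in \<open>E\<close>. Colours are
  natural numbers; colour \<open>i\<close> has edge set \<open>E i\<close>.\<close>

locale tiling =
  fixes cp :: "'a set set \<Rightarrow> 'a set \<Rightarrow> bool" and r M :: nat and c :: real
  assumes r_pos: "0 < r" and M_pos: "0 < M" and c_nonneg: "0 \<le> c"
    and cp_card: "cp E S \<Longrightarrow> finite S \<and> card S = r"
    and cp_local: "cp E S \<Longrightarrow> E \<inter> Pow S \<subseteq> E' \<Longrightarrow> cp E' S"
    and tile: "\<lbrakk>finite U; M \<le> card U; r dvd card U; \<forall>e\<in>E. card e = 2;
      \<forall>v\<in>U. c * card U \<le> card (nbh E v \<inter> U)\<rbrakk>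
      \<Longrightarrow> \<exists>\<S>. disjoint \<S> \<and> \<Union>\<S> = U \<and> (\<forall>S\<in>\<S>. cp E S)"
begin

text \<open>Covering \<open>U\<close> is not demanded, which makes the notion monotone in
  \<open>U\<close>; in the final application the sizes force it.\<close>

definition assignable :: "(nat \<Rightarrow> 'a set set) \<Rightarrow> nat set \<Rightarrow> 'a set \<Rightarrow> bool" where
  "assignable E C U \<longleftrightarrow> (\<exists>f. (\<forall>i\<in>C. cp (E i) (f i) \<and> f i \<subseteq> U) \<and> disjoint_family_on f C)"

lemma assignable_mono: "assignable E C U \<Longrightarrow> U \<subseteq> V \<Longrightarrow> assignable E C V"
  unfolding assignable_def by (meson order_trans)

lemma assignable_UN:
  assumes "disjoint_family_on C B" "disjoint_family_on U B" "\<And>b. b \<in> B \<Longrightarrow> assignable E (C b) (U b)"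
  shows "assignable E (\<Union>b\<in>B. C b) (\<Union>b\<in>B. U b)"
proof -
  have "\<forall>b\<in>B. \<exists>f. (\<forall>i\<in>C b. cp (E i) (f i) \<and> f i \<subseteq> U b) \<and> disjoint_family_on f (C b)"
    using assms(3) by (auto simp: assignable_def)
  then obtain f where f: "\<And>b i. b \<in> B \<Longrightarrow> i \<in> C b \<Longrightarrow> cp (E i) (f b i) \<and> f b i \<subseteq> U b"
    "\<And>b. b \<in> B \<Longrightarrow> disjoint_family_on (f b) (C b)" by metis
  define g where "g i = (SOME b. b \<in> B \<and> i \<in> C b)" for i
  have g: "g i \<in> B" "i \<in> C (g i)" if "i \<in> (\<Union>b\<in>B. C b)" for i
    using someI_ex[of "\<lambda>b. b \<in> B \<and> i \<in> C b"] that by (auto simp: g_def)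
  have "(\<forall>i\<in>(\<Union>b\<in>B. C b). cp (E i) (f (g i) i) \<and> f (g i) i \<subseteq> (\<Union>b\<in>B. U b))"
    using f(1) g by blast
  moreover have "disjoint_family_on (\<lambda>i. f (g i) i) (\<Union>b\<in>B. C b)"
    unfolding disjoint_family_on_def
  proof (intro ballI impI)
    fix i j assume ij: "i \<in> (\<Union>b\<in>B. C b)" "j \<in> (\<Union>b\<in>B. C b)" "i \<noteq> j"
    show "f (g i) i \<inter> f (g j) j = {}"
    proof (cases "g i = g j")
      case True
      then show ?thesis using f(2)[OF g(1)[OF ij(1)]] g(2)[OF ij(1)] g(2)[OF ij(2)] ij(3)
        by (auto simp: disjoint_family_on_def)
    next
      case False
      then have "U (g i) \<inter> U (g j) = {}" using assms(2) g ij by (auto simp: disjoint_family_on_def)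
      then show ?thesis using f(1) g ij by blast
    qed
  qed
  ultimately show ?thesis unfolding assignable_def by (intro exI[of _ "\<lambda>i. f (g i) i"]) blast
qed

lemma assignable_Un:
  assumes "C \<inter> C' = {}" "U \<inter> U' = {}" "assignable E C U" "assignable E C' U'"
  shows "assignable E (C \<union> C') (U \<union> U')"
proof -
  have "assignable E (\<Union>b\<in>UNIV. if b then C else C') (\<Union>b\<in>UNIV. if b then U else U')"
    using assms by (intro assignable_UN) (auto simp: disjoint_family_on_def)
  then show ?thesis by (simp add: UNIV_bool Un_commute)
qed

text \<open>The tiling is found for one colour \<open>i0\<close>. By \<open>cp_local\<close> only
  edges inside a member matter, and on these all colours of \<open>D\<close> agree, so any bijection
  from \<open>D\<close> to the members will do.\<close>

lemma assignable_same_induced: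
  assumes U: "finite U" "card U = q * r" "M \<le> q * r" and D: "finite D" "card D = q"
    and simple: "\<And>i e. i \<in> D \<Longrightarrow> e \<in> E i \<Longrightarrow> card e = 2"
    and deg: "\<And>i v. i \<in> D \<Longrightarrow> v \<in> U \<Longrightarrow> c * card U \<le> card (nbh (E i) v \<inter> U)"
    and same: "\<And>i j. i \<in> D \<Longrightarrow> j \<in> D \<Longrightarrow> E i \<inter> Pow U = E j \<inter> Pow U"
  shows "assignable E D U"
proof -
  have "D \<noteq> {}" using D U M_pos by auto
  then obtain i0 where i0: "i0 \<in> D" by blast
  obtain \<S> where \<S>: "disjoint \<S>" "\<Union>\<S> = U" "\<forall>S\<in>\<S>. cp (E i0) S"
    using tile[of U "E i0"] U simple[OF i0] deg[OF i0] by auto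
  have fS: "finite \<S>" using \<S>(2) U(1) by (metis finite_UnionD)
  have "card U = (\<Sum>S\<in>\<S>. card S)"
    using \<S> cp_card by (metis card_Union_disjoint disjoint_def pairwise_def disjnt_def)
  also have "\<dots> = (\<Sum>S\<in>\<S>. r)" using \<S>(3) cp_card by (intro sum.cong) blast+
  also have "\<dots> = card \<S> * r" by simp
  finally have "card \<S> = q" using U r_pos by simp
  then obtain h where h: "bij_betw h D \<S>" using D fS finite_same_card_bij by metis
  have "cp (E i) (h i) \<and> h i \<subseteq> U" if "i \<in> D" for i
  proof -
    have hi: "h i \<in> \<S>" using h that by (auto simp: bij_betw_def)
    then have "h i \<subseteq> U" using \<S> by blast
    then have "E i0 \<inter> Pow (h i) \<subseteq> E i" using same[OF i0 that] by blast
    then show ?thesis using cp_local \<S>(3) hi \<open>h i \<subseteq> U\<close> by blast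
  qed
  moreover have "disjoint_family_on h D"
    unfolding disjoint_family_on_def
  proof (intro ballI impI)
    fix i j assume "i \<in> D" "j \<in> D" "i \<noteq> j"
    then have "h i \<in> \<S>" "h j \<in> \<S>" "h i \<noteq> h j" using h by (auto simp: bij_betw_def inj_on_def)
    then show "h i \<inter> h j = {}" using \<S>(1) by (rule disjointD[rotated])
  qed
  ultimately show ?thesis unfolding assignable_def by blast
qed

text \<open>The copy for \<open>x\<close> is a member of a tiling of \<open>U\<close> in colour
  \<open>x\<close>; on the rest of \<open>U\<close> the other colours still agree. Deleting the copy
  costs a vertex at most \<open>r\<close> neighbours, hence the summand \<open>r\<close> in the
  degree hypothesis.\<close>

lemma assignable_absorb:
  assumes U: "finite U" "card U = Suc q * r" "M \<le> q * r" and D: "finite D" "card D = q" "x \<notin> D"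
    and simple: "\<And>i e. i \<in> insert x D \<Longrightarrow> e \<in> E i \<Longrightarrow> card e = 2"
    and deg: "\<And>i v. i \<in> insert x D \<Longrightarrow> v \<in> U \<Longrightarrow> c * card U + r \<le> card (nbh (E i) v \<inter> U)"
    and same: "\<And>i j. i \<in> D \<Longrightarrow> j \<in> D \<Longrightarrow> E i \<inter> Pow U = E j \<inter> Pow U"
  shows "assignable E (insert x D) U"
proof -
  have "\<forall>v\<in>U. c * card U \<le> card (nbh (E x) v \<inter> U)" using deg[of x] by force
  then obtain \<S> where \<S>: "disjoint \<S>" "\<Union>\<S> = U" "\<forall>S\<in>\<S>. cp (E x) S"
    using tile[of U "E x"] U simple[of x] by auto
  have "U \<noteq> {}" using U r_pos by auto
  then obtain S where S: "S \<subseteq> U" "cp (E x) S" using \<S> by blast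
  have cS: "finite S" "card S = r" using cp_card[OF S(2)] by auto
  have cUS: "card (U - S) = q * r" using U S cS by (simp add: card_Diff_subset)
  have "assignable E D (U - S)"
  proof (rule assignable_same_induced[OF _ cUS U(3) D(1,2)])
    fix i v assume i: "i \<in> D" "v \<in> U - S"
    have "card (nbh (E i) v \<inter> U) \<le> card ((nbh (E i) v \<inter> (U - S)) \<union> S)"
      using U cS by (intro card_mono) auto
    also have "\<dots> \<le> card (nbh (E i) v \<inter> (U - S)) + r" using card_Un_le[of _ S] cS by metis
    finally have "card (nbh (E i) v \<inter> U) \<le> card (nbh (E i) v \<inter> (U - S)) + r" .
    moreover have "c * card (U - S) \<le> c * card U"
      using c_nonneg U(1) by (intro mult_left_mono) (auto intro: card_mono)
    ultimately show "c * card (U - S) \<le> card (nbh (E i) v \<inter> (U - S))" using deg[of i v] i by auto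
  next
    fix i j assume "i \<in> D" "j \<in> D"
    then have "E i \<inter> Pow U = E j \<inter> Pow U" by (rule same)
    then show "E i \<inter> Pow (U - S) = E j \<inter> Pow (U - S)" by blast
  qed (use U simple in auto)
  moreover have "assignable E {x} S"
    unfolding assignable_def using S by (intro exI[of _ "\<lambda>_. S"]) (auto simp: disjoint_family_on_def)
  ultimately have "assignable E ({x} \<union> D) (S \<union> (U - S))" using D by (intro assignable_Un) auto
  moreover have "S \<union> (U - S) = U" using S by auto
  ultimately show ?thesis by simp
qed

text \<open>The copy through \<open>v\<close> is the member containing \<open>v\<close> of a tiling
  of all uncovered vertices. At most \<open>r * k * n\<close> vertices are covered, so the slack
  \<open>k\<close> keeps the degrees high enough.\<close>

lemma extend_partial_assignment:
  fixes k :: real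
  assumes V: "finite V" "card V = r * n"
    and deg: "\<And>v. v \<in> V \<Longrightarrow> (c + k) * real (r * n) \<le> card (nbh E' v)"
    and nb: "\<And>v. v \<in> V \<Longrightarrow> nbh E' v \<subseteq> V"
    and simple: "\<And>e. e \<in> E' \<Longrightarrow> card e = 2"
    and C: "finite C" "real (card C) \<le> k * n" "M \<le> r * (n - card C)"
    and f: "\<And>i. i \<in> C \<Longrightarrow> cp (E i) (f i) \<and> f i \<subseteq> V" "disjoint_family_on f C"
    and v: "v \<in> V - (\<Union>i\<in>C. f i)"
  shows "\<exists>S. v \<in> S \<and> S \<subseteq> V - (\<Union>i\<in>C. f i) \<and> cp E' S"
proof -
  define Z where "Z = (\<Union>i\<in>C. f i)"
  have cf: "finite (f i)" "card (f i) = r" if "i \<in> C" for i using f(1)[OF that] cp_card by blast+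
  have "card Z = (\<Sum>i\<in>C. card (f i))"
    unfolding Z_def using C(1) f(2) cf(1) by (intro card_UN_disjoint) (auto simp: disjoint_family_on_def)
  also have "\<dots> = r * card C" using cf by simp
  finally have cZ: "card Z = r * card C" .
  have ZV: "Z \<subseteq> V" using f by (auto simp: Z_def)
  have fZ: "finite Z" using ZV V finite_subset by blast
  have cU: "card (V - Z) = r * (n - card C)" using V ZV fZ cZ by (simp add: card_Diff_subset diff_mult_distrib2)
  have "\<forall>u\<in>V - Z. c * card (V - Z) \<le> card (nbh E' u \<inter> (V - Z))"
  proof
    fix u assume u: "u \<in> V - Z"
    have "card (nbh E' u) \<le> card ((nbh E' u \<inter> (V - Z)) \<union> Z)"
      using nb[of u] u V fZ by (intro card_mono) auto
    also have "\<dots> \<le> card (nbh E' u \<inter> (V - Z)) + r * card C" using card_Un_le[of _ Z] cZ by metis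
    finally have "real (card (nbh E' u)) \<le> real (card (nbh E' u \<inter> (V - Z))) + real r * real (card C)"
      by (metis of_nat_add of_nat_le_iff of_nat_mult)
    moreover have "real r * real (card C) \<le> real r * (k * n)" using C(2) by (intro mult_left_mono) auto
    moreover have "(c + k) * real (r * n) = c * real (r * n) + real r * (k * n)" by (simp add: algebra_simps)
    moreover have "c * card (V - Z) \<le> c * real (r * n)"
      using c_nonneg V by (intro mult_left_mono) (auto simp flip: V(2) intro: card_mono)
    ultimately show "c * card (V - Z) \<le> card (nbh E' u \<inter> (V - Z))" using deg[of u] u by auto
  qed
  then obtain \<S> where "disjoint \<S>" "\<Union>\<S> = V - Z" "\<forall>S\<in>\<S>. cp E' S"
    using tile[of "V - Z" E'] V C simple cU by auto
  then show ?thesis using v unfolding Z_def by (metis Union_iff Union_upper)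
qed

lemma cover_exceptional:
  fixes k :: real
  assumes V: "finite V" "card V = r * n"
    and deg: "\<And>i v. i < n \<Longrightarrow> v \<in> V \<Longrightarrow> (c + k) * real (r * n) \<le> card (nbh (E i) v)"
    and nb: "\<And>i v. i < n \<Longrightarrow> v \<in> V \<Longrightarrow> nbh (E i) v \<subseteq> V"
    and simple: "\<And>i e. i < n \<Longrightarrow> e \<in> E i \<Longrightarrow> card e = 2"
    and A: "A \<subseteq> {..<n}" and B: "B \<subseteq> V"
    and L: "card A + card B \<le> L" "real L \<le> k * n" "M \<le> r * (n - L)"
  shows "\<exists>C f. A \<subseteq> C \<and> C \<subseteq> {..<n} \<and> card C \<le> L \<and> (\<forall>i\<in>C. cp (E i) (f i) \<and> f i \<subseteq> V) \<and>
    disjoint_family_on f C \<and> B \<subseteq> (\<Union>i\<in>C. f i)"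
proof -
  define part where "part C f \<longleftrightarrow> C \<subseteq> {..<n} \<and> (\<forall>i\<in>C. cp (E i) (f i) \<and> f i \<subseteq> V) \<and> disjoint_family_on f C"
    for C f
  have Ln: "L < n" using L(3) M_pos by (metis diff_is_0_eq linorder_not_le mult_0_right)
  have finC: "finite C" if "part C f" for C f using that finite_subset unfolding part_def by blast
  have ext: "\<exists>S. v \<in> S \<and> part (insert i C) (f(i := S))"
    if p: "part C f" and i: "i < n" "i \<notin> C" and v: "v \<in> V - (\<Union>i\<in>C. f i)" and cC: "card C \<le> L" for C f i v
  proof -
    have "real (card C) \<le> k * n" using cC L(2) by linarith
    moreover have "M \<le> r * (n - card C)" using cC L(3) by (meson diff_le_mono2 le_trans mult_le_mono2)
    ultimately obtain S where S: "v \<in> S" "S \<subseteq> V - (\<Union>i\<in>C. f i)" "cp (E i) S"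
      using extend_partial_assignment[OF V deg[OF i(1)] nb[OF i(1)] simple[OF i(1)] finC[OF p], where f = f and v = v and E = E] p v
      unfolding part_def by blast
    have "part (insert i C) (f(i := S))"
      using p i S unfolding part_def disjoint_family_on_def by auto
    then show ?thesis using S by blast
  qed
  have stepA: "\<exists>f. part A' f" if "A' \<subseteq> A" for A'
    using finite_subset[OF that finite_subset[OF A finite_lessThan]] that
  proof (induction A' rule: finite_induct)
    case empty
    then show ?case by (auto simp: part_def disjoint_family_on_def)
  next
    case (insert i A')
    then obtain f where f: "part A' f" by auto
    have cA: "card A' \<le> L" using insert L(1) A by (meson add_leD1 card_mono finite_lessThan finite_subset insert_subset le_trans)
    have "card (\<Union>i\<in>A'. f i) \<le> (\<Sum>i\<in>A'. card (f i))" by (rule card_UN_le) (rule insert.hyps)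
    also have "\<dots> = (\<Sum>i\<in>A'. r)" using f cp_card unfolding part_def by (intro sum.cong) blast+
    also have "\<dots> = card A' * r" by simp
    also have "\<dots> < card V" using cA Ln V r_pos by simp
    finally have "(\<Union>i\<in>A'. f i) \<noteq> V" by auto
    moreover have "(\<Union>i\<in>A'. f i) \<subseteq> V" using f by (auto simp: part_def)
    ultimately obtain v where "v \<in> V - (\<Union>i\<in>A'. f i)" by blast
    then show ?case using ext[OF f, of i v] insert cA A by auto
  qed
  have stepB: "\<exists>C f. A \<subseteq> C \<and> part C f \<and> card C \<le> card A + card B' \<and> B' \<subseteq> (\<Union>i\<in>C. f i)" if "B' \<subseteq> B" for B'
    using finite_subset[OF that finite_subset[OF B V(1)]] that
  proof (induction B' rule: finite_induct)
    case empty
    obtain f where "part A f" using stepA by blast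
    then show ?case by (intro exI[of _ A] exI[of _ f]) auto
  next
    case (insert v B')
    then obtain C f where C: "A \<subseteq> C" "part C f" "card C \<le> card A + card B'" "B' \<subseteq> (\<Union>i\<in>C. f i)" by auto
    show ?case
    proof (cases "v \<in> (\<Union>i\<in>C. f i)")
      case True
      then show ?thesis using C insert.hyps by (intro exI[of _ C] exI[of _ f]) auto
    next
      case False
      have "card B' \<le> card B" using insert.prems B V by (meson card_mono finite_subset insert_subset)
      then have cL: "card C \<le> L" using C L by linarith
      then have "card C < card {..<n}" using Ln by simp
      then obtain i where i: "i < n" "i \<notin> C" using C(2) by (metis card_mono finC leD lessThan_iff subsetI)
      obtain S where S: "v \<in> S" "part (insert i C) (f(i := S))"
        using ext[OF C(2) i, of v] False cL insert.prems B by auto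
      have "card (insert i C) \<le> card A + card (insert v B')"
        using C(3) i finC[OF C(2)] insert.hyps by simp
      moreover have "insert v B' \<subseteq> (\<Union>j\<in>insert i C. (f(i := S)) j)" using S(1) C(4) i by auto
      ultimately show ?thesis using C(1) S(2) by (meson subset_insertI2)
    qed
  qed
  obtain C f where C: "A \<subseteq> C" "part C f" "card C \<le> card A + card B" "B \<subseteq> (\<Union>i\<in>C. f i)"
    using stepB[OF order_refl] by (elim exE conjE) blast
  have "card C \<le> L" using C(3) L(1) by linarith
  then show ?thesis using C(1,2,4) unfolding part_def by (intro exI[of _ C] exI[of _ f]) simp
qed

text \<open>Everything after the random choice. The size of \<eta> reflects the losses: covering
  uses at most \<open>2 * r * \<eta> * n\<close> copies, each copy hits at most \<open>r\<close>
  blocks, each dissolved block releases at most \<open>T\<close> sets of size \<open>r\<close>, and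
  \<open>n\<close> is about \<open>T * N\<close>. The total must be a small fraction of
  \<open>N\<close>.\<close>

lemma assignable_of_blocks:
  fixes k \<eta> :: real and n N T :: nat and U :: "nat \<Rightarrow> 'a set"
  assumes V: "finite V" "card V = r * n"
    and deg: "\<And>i v. i < n \<Longrightarrow> v \<in> V \<Longrightarrow> (c + 3 * k) * real (r * n) \<le> card (nbh (E i) v)"
    and nb: "\<And>i v. i < n \<Longrightarrow> v \<in> V \<Longrightarrow> nbh (E i) v \<subseteq> V"
    and simple: "\<And>i e. i < n \<Longrightarrow> e \<in> E i \<Longrightarrow> card e = 2"
    and k: "0 < k"
    and T: "0 < T" "M \<le> (T - 1) * r" "1 \<le> 2 * k * T" "c \<le> 2 * k * T"
    and \<eta>: "\<eta> = 1 / (100 * (real r)\<^sup>2 * (real T)\<^sup>2)"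
    and N: "N = n div T" "100 * T \<le> N" "4 * (2 ^ 2 ^ (r * (T + 1)) * (T + 1)) < N" "2 * M \<le> n"
    and U: "\<And>j. j < N \<Longrightarrow> U j \<subseteq> V" "\<And>j. j < N \<Longrightarrow> card (U j) = r * T" "disjoint_family_on U {..<N}"
    and few: "real (card {(i, j, v) \<in> {..<n} \<times> {..<N} \<times> V. deficient (E i) ((c + 2 * k) * (r * T)) (U j) v})
      \<le> \<eta> ^ 3 * (real n * real N * real (card V))"
  shows "assignable E {..<n} V"
proof -
  define s0 where "s0 = (c + 2 * k) * real (r * T)"
  define df where "df i j v = deficient (E i) s0 (U j) v" for i j v
  define pb where "pb i j \<longleftrightarrow> (\<exists>u\<in>U j. real (card (nbh (E i) u \<inter> U j)) < s0)" for i j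
  define bj where "bj j v \<longleftrightarrow> \<eta> * n < card {i. i < n \<and> df i j v}" for j v
  \<comment> \<open>exceptional colours, blocks and vertices\<close>
  define Ec where "Ec = {i. i < n \<and> \<eta> * N < card {j. j < N \<and> pb i j}}"
  define Eb where "Eb = {j. j < N \<and> \<eta> * n < card {i. i < n \<and> pb i j}}"
  define Ev where "Ev = {v \<in> V. \<eta> * N < card {j. j < N \<and> bj j v}}"

  have N0: "0 < N" using N T by linarith
  have n0: "0 < n" using N N0 by (metis div_0 gr0I less_irrefl)
  have r1: "1 \<le> real r" and T1: "1 \<le> real T" using r_pos T by auto
  have q: "1 \<le> (real r)\<^sup>2" "1 \<le> (real T)\<^sup>2" "real T \<le> (real T)\<^sup>2" "real r \<le> (real r)\<^sup>2"
    using r1 T1 by (auto simp: power2_eq_square mult_le_cancel_left1 intro: mult_ge1_I)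
  have \<eta>0: "0 < \<eta>" using r1 T1 by (simp add: \<eta>)
  have \<eta>T: "(real r)\<^sup>2 * (real T)\<^sup>2 * \<eta> = 1 / 100" using r1 T1 by (simp add: \<eta>)
  have \<eta>T': "real T * \<eta> \<le> 1 / 100" "real r * \<eta> \<le> 1 / 100" "\<eta> \<le> 1 / 100" "real r * real T * \<eta> \<le> 1 / 100"
  proof -
    have "1 * real T \<le> (real r)\<^sup>2 * (real T)\<^sup>2" using q by (intro mult_mono) auto
    then show "real T * \<eta> \<le> 1 / 100" using \<eta>T \<eta>0 by (metis mult_1 mult_right_mono less_imp_le)
    have "real r * 1 \<le> (real r)\<^sup>2 * (real T)\<^sup>2" using q by (intro mult_mono) auto
    then show "real r * \<eta> \<le> 1 / 100" using \<eta>T \<eta>0 by (metis mult.right_neutral mult_right_mono less_imp_le)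
    have "1 * 1 \<le> (real r)\<^sup>2 * (real T)\<^sup>2" using q by (intro mult_mono) auto
    then show "\<eta> \<le> 1 / 100" using \<eta>T \<eta>0 by (metis mult_1 mult_right_mono less_imp_le)
    have "real r * real T \<le> (real r)\<^sup>2 * (real T)\<^sup>2" using q by (intro mult_mono) auto
    then show "real r * real T * \<eta> \<le> 1 / 100" using \<eta>T \<eta>0 by (metis mult_right_mono less_imp_le)
  qed
  have nT: "n < T * N + T" "T * N \<le> n"
    using N(1) T(1) by (auto simp: mult.commute) (metis add.commute dividend_less_div_times mult.commute)
  moreover have "T \<le> T * N" using N0 by simp
  ultimately have "n \<le> 2 * (T * N)" by linarith
  then have "real n \<le> real (2 * (T * N))" by (simp only: of_nat_le_iff)
  then have n2: "real n \<le> 2 * real T * real N" by simp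
  define a where "a = \<eta> * n"
  have a0: "0 \<le> a" using \<eta>0 by (simp add: a_def)
  \<comment> \<open>Fractions of \<open>n\<close> become fractions of \<open>N\<close> through
    \<open>n \<le> 2 * T * N\<close>; this uses the second factor \<open>T\<close> in
    \<eta>.\<close>
  have ra: "(real r)\<^sup>2 * real T * a \<le> N / 50"
  proof -
    have "(real r)\<^sup>2 * real T * a \<le> (real r)\<^sup>2 * real T * (\<eta> * (2 * real T * real N))"
      unfolding a_def using n2 \<eta>0 by (intro mult_left_mono) auto
    also have "\<dots> = 2 * ((real r)\<^sup>2 * (real T)\<^sup>2 * \<eta>) * N" by (simp add: power2_eq_square)
    also have "\<dots> = N / 50" by (simp add: \<eta>T)
    finally show ?thesis .
  qed
  have ra1: "real r * a \<le> N / 50" "a \<le> N / 50"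
  proof -
    have "real r * 1 \<le> (real r)\<^sup>2 * real T" using q T1 by (intro mult_mono) auto
    then have *: "real r * a \<le> (real r)\<^sup>2 * real T * a" using a0 by (metis mult.right_neutral mult_right_mono)
    then show "real r * a \<le> N / 50" using ra by linarith
    moreover have "1 * a \<le> real r * a" using r1 a0 by (intro mult_right_mono)
    ultimately show "a \<le> N / 50" by linarith
  qed

  have pbdf: "df i j v" if "pb i j" for i j v using that unfolding pb_def df_def deficient_def by blast
  have few': "real (card {(i, j, v) \<in> {..<n} \<times> {..<N} \<times> V. df i j v}) \<le> \<eta> ^ 3 * (real n * real N * real (card V))"
    using few unfolding df_def s0_def by simp
  have Vne: "V \<noteq> {}" using V r_pos n0 by auto
  have \<eta>1: "\<eta> \<le> 1" using \<eta>T'(3) by simp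
  have cEc: "real (card Ec) \<le> a" and cEb: "real (card Eb) \<le> \<eta> * N" and cEv: "real (card Ev) \<le> real r * a"
    using exceptional_sets_small[OF V(1) Vne n0 N0 \<eta>0 \<eta>1 pbdf few'] V(2)
    unfolding Ec_def Eb_def Ev_def bj_def a_def by (auto simp: algebra_simps)

  define L where "L = card Ec + card Ev"
  have L: "real L \<le> 2 * (real r * a)"
  proof -
    have "a \<le> real r * a" using r1 a0 by (simp add: mult_le_cancel_right1)
    then show ?thesis using cEc cEv unfolding L_def by simp
  qed
  have L3: "real L \<le> 3 * k * n"
  proof -
    have "2 * (real r * \<eta>) * T \<le> 2 * k * T" using \<eta>T'(4) T(3) by (simp add: mult.commute mult.left_commute)
    then have "2 * (real r * \<eta>) \<le> 2 * k" using T(1) by simp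
    then have "2 * (real r * \<eta>) * n \<le> 2 * k * n" by (rule mult_right_mono) simp
    then show ?thesis using L k by (simp add: a_def algebra_simps)
  qed
  have Ln: "M \<le> r * (n - L)"
  proof -
    have "2 * (real r * \<eta>) * n \<le> 1 / 2 * n" using \<eta>T'(2) by (intro mult_right_mono) auto
    then have "2 * real L \<le> n" using L by (simp add: a_def algebra_simps)
    then have "2 * L \<le> n" by linarith
    then have "M \<le> n - L" using N(4) by linarith
    also have "\<dots> \<le> r * (n - L)" using r_pos by simp
    finally show ?thesis .
  qed
  have EcEv: "Ec \<subseteq> {..<n}" "Ev \<subseteq> V" by (auto simp: Ec_def Ev_def)
  \<comment> \<open>The whole slack \<open>3 * k\<close> takes the place of \<open>k\<close> in
    \<open>cover_exceptional\<close>, since these degrees are those in \<open>V\<close> and not in a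
    block.\<close>
  have "\<exists>C f. Ec \<subseteq> C \<and> C \<subseteq> {..<n} \<and> card C \<le> L \<and> (\<forall>i\<in>C. cp (E i) (f i) \<and> f i \<subseteq> V) \<and>
      disjoint_family_on f C \<and> Ev \<subseteq> (\<Union>i\<in>C. f i)"
  proof (rule cover_exceptional[OF V _ _ _ EcEv _ L3 Ln])
    show "card e = 2" if "i < n" "e \<in> E i" for i e using simple that .
  qed (use deg nb L_def in auto)
  then obtain C f where C: "Ec \<subseteq> C" "C \<subseteq> {..<n}" "card C \<le> L" "\<forall>i\<in>C. cp (E i) (f i) \<and> f i \<subseteq> V"
    "disjoint_family_on f C" "Ev \<subseteq> (\<Union>i\<in>C. f i)"
    by (elim exE conjE) blast
  have fC: "finite C" using C(2) finite_subset by blast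
  define Z where "Z = (\<Union>i\<in>C. f i)"
  have asgC: "assignable E C Z" unfolding assignable_def Z_def using C by blast
  have cf: "finite (f i)" "card (f i) = r" if "i \<in> C" for i using C(4) cp_card that by blast+
  have cZ: "card Z = r * card C"
  proof -
    have "card Z = (\<Sum>i\<in>C. card (f i))"
      unfolding Z_def using fC C(5) cf by (intro card_UN_disjoint) (auto simp: disjoint_family_on_def)
    also have "\<dots> = r * card C" using cf by simp
    finally show ?thesis .
  qed
  have ZV: "Z \<subseteq> V" using C(4) by (auto simp: Z_def)
  have fZ: "finite Z" using ZV V finite_subset by blast

  define Hb where "Hb = {j. j < N \<and> U j \<inter> Z \<noteq> {}}"
  \<comment> \<open>The blocks are disjoint, so each hit block can be charged to a vertex of
    \<open>Z\<close> of its own.\<close>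
  have "card Hb \<le> card Z"
  proof -
    have "\<forall>j\<in>Hb. \<exists>z. z \<in> U j \<inter> Z" by (auto simp: Hb_def)
    then obtain z where z: "\<And>j. j \<in> Hb \<Longrightarrow> z j \<in> U j \<inter> Z" by metis
    have "inj_on z Hb"
    proof (rule inj_onI, rule ccontr)
      fix i j assume ij: "i \<in> Hb" "j \<in> Hb" "z i = z j" "i \<noteq> j"
      then have "U i \<inter> U j = {}" using U(3) by (auto simp: disjoint_family_on_def Hb_def)
      then show False using z ij by (metis IntD1 disjoint_iff)
    qed
    then show ?thesis using z fZ by (intro card_inj_on_le[of z]) auto
  qed
  then have "real (card Hb) \<le> real r * real (card C)" using cZ by (metis of_nat_le_iff of_nat_mult)
  also have "\<dots> \<le> real r * (2 * (real r * a))" using C(3) L by (intro mult_left_mono) auto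
  finally have "real T * real (card Hb) \<le> real T * (real r * (2 * (real r * a)))" by (intro mult_left_mono) auto
  also have "\<dots> = 2 * ((real r)\<^sup>2 * real T * a)" by (simp add: power2_eq_square)
  finally have cHb: "real T * real (card Hb) \<le> N / 25" using ra by linarith
  have cEb': "real T * real (card Eb) \<le> N / 100"
  proof -
    have "real T * real (card Eb) \<le> real T * (\<eta> * N)" using cEb by (intro mult_left_mono) auto
    also have "\<dots> = (real T * \<eta>) * N" by simp
    also have "\<dots> \<le> 1 / 100 * N" using \<eta>T'(1) by (intro mult_right_mono) auto
    finally show ?thesis by simp
  qed
  \<comment> \<open>the dissolved blocks; their vertices left uncovered by \<open>Z\<close> end up in \<open>W\<close>\<close>
  define Dd where "Dd = Eb \<union> Hb"
  define J0 where "J0 = {..<N} - Dd"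
  have DdN: "Dd \<subseteq> {..<N}" by (auto simp: Dd_def Eb_def Hb_def)
  have cDd: "real T * real (card Dd) \<le> N / 20"
  proof -
    have "real (card Dd) \<le> real (card Eb) + real (card Hb)"
      unfolding Dd_def by (metis card_Un_le of_nat_add of_nat_le_iff)
    then have "real T * real (card Dd) \<le> real T * (real (card Eb) + real (card Hb))" by (intro mult_left_mono) auto
    then show ?thesis using cHb cEb' by (simp add: distrib_left)
  qed
  have cDd1: "real (card Dd) \<le> N / 20"
  proof -
    have "1 * real (card Dd) \<le> real T * real (card Dd)" using T1 by (intro mult_right_mono) auto
    then show ?thesis using cDd by linarith
  qed
  have cJ0: "card J0 + card Dd = N"
    using DdN card_mono[OF _ DdN] unfolding J0_def by (simp add: card_Diff_subset finite_subset)
  have J0N: "j < N" if "j \<in> J0" for j using that by (auto simp: J0_def)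
  have fJ0: "finite J0" by (simp add: J0_def)
  have fU: "finite (U j)" if "j < N" for j using U(1)[OF that] V finite_subset by blast

  define UJ where "UJ = (\<Union>j\<in>J0. U j)"
  \<comment> \<open>Besides the remains of dissolved blocks, \<open>W\<close> contains those of the
    fewer than \<open>r * T\<close> vertices in no block that \<open>Z\<close> misses, as
    \<open>T\<close> need not divide \<open>n\<close>. They cause the summand \<open>T\<close> in
    the bound on \<open>s\<close>.\<close>
  define W where "W = V - Z - UJ"
  have cUJ: "card UJ = card J0 * (r * T)"
  proof -
    have "card UJ = (\<Sum>j\<in>J0. card (U j))"
      unfolding UJ_def using fJ0 fU J0N U(3) by (intro card_UN_disjoint) (auto simp: disjoint_family_on_def)
    also have "\<dots> = (\<Sum>j\<in>J0. r * T)" using U(2) J0N by (intro sum.cong) auto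
    finally show ?thesis by simp
  qed
  have UJZ: "UJ \<inter> Z = {}" by (auto simp: UJ_def J0_def Dd_def Hb_def)
  have UJV: "UJ \<subseteq> V" using U(1) J0N by (auto simp: UJ_def)
  have fUJ: "finite UJ" using UJV V finite_subset by blast
  have cW: "card W + card Z + card UJ = card V"
  proof -
    have "card (Z \<union> UJ) = card Z + card UJ" using fZ fUJ UJZ by (intro card_Un_disjoint) auto
    moreover have "card W = card V - card (Z \<union> UJ)"
    proof -
      have "W = V - (Z \<union> UJ)" by (auto simp: W_def)
      then show ?thesis using ZV UJV fZ fUJ by (simp add: card_Diff_subset)
    qed
    moreover have "card (Z \<union> UJ) \<le> card V" using ZV UJV V by (intro card_mono) auto
    ultimately show ?thesis by linarith
  qed
  \<comment> \<open>As \<open>card V\<close>, \<open>card Z\<close> and \<open>card UJ\<close> are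
    multiples of \<open>r\<close>, so is \<open>card W\<close>. The subtraction turns out to be
    exact, and \<open>sn\<close> is the count that later makes both sides of the matching equal in
    size.\<close>
  define s where "s = n - (card C + card J0 * T)"
  have "card W + r * (card C + card J0 * T) = r * n"
    using cW cZ cUJ V(2) by (simp add: algebra_simps)
  then have "card W = r * n - r * (card C + card J0 * T)" by simp
  then have cWs: "card W = s * r" by (simp add: s_def diff_mult_distrib2 mult.commute)
  have "r * (card C + card J0 * T) \<le> r * n" using \<open>card W + r * (card C + card J0 * T) = r * n\<close> by linarith
  then have sn: "s + card C + card J0 * T = n" using r_pos by (simp add: s_def)
  have cs: "real s \<le> 6 * N / 100"
  proof -
    have "s + card J0 * T \<le> T * N + T" using sn nT by linarith
    then have "s + card J0 * T \<le> T * (card J0 + card Dd) + T" using cJ0 by simp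
    then have "s \<le> T * card Dd + T" by (simp add: algebra_simps)
    then have "real s \<le> real T * real (card Dd) + real T" by (metis of_nat_add of_nat_le_iff of_nat_mult)
    moreover have "real T \<le> N / 100" using N(2) by linarith
    ultimately show ?thesis using cDd by linarith
  qed
  have fW: "finite W" using V by (simp add: W_def)
  obtain \<Q> where \<Q>: "finite \<Q>" "card \<Q> = s" "disjoint \<Q>" "\<Union>\<Q> = W" "\<forall>Q\<in>\<Q>. card Q = r"
    using split_into_equal_sets[OF fW cWs r_pos] by blast
  have WV: "W \<subseteq> V" and WEv: "v \<notin> Ev" if "v \<in> W" for v
    using that C(6) by (auto simp: W_def Z_def)
  have bjW: "real (card {j. j < N \<and> bj j v}) \<le> \<eta> * N" if "v \<in> W" for v
    using WEv[OF that] WV that unfolding Ev_def by auto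
  \<comment> \<open>A set \<open>Q\<close> rules out at most \<open>N / 100\<close> blocks, as its
    vertices are not exceptional. At least \<open>94 * N / 100\<close> blocks remain for it, against
    at most \<open>6 * N / 100\<close> sets in total, so distinct ones can be chosen
    greedily.\<close>
  have "\<exists>g. inj_on g \<Q> \<and> (\<forall>Q\<in>\<Q>. g Q \<in> {j \<in> J0. \<forall>v\<in>Q. \<not> bj j v})"
  proof (rule greedy_injection[OF \<Q>(1)])
    fix Q assume Q: "Q \<in> \<Q>"
    let ?A = "{j \<in> J0. \<forall>v\<in>Q. \<not> bj j v}"
    have fQ: "finite Q" using Q \<Q>(5) r_pos by (metis card.infinite less_irrefl)
    have "J0 \<subseteq> ?A \<union> (\<Union>v\<in>Q. {j. j < N \<and> bj j v})" using J0N by auto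
    then have "card J0 \<le> card (?A \<union> (\<Union>v\<in>Q. {j. j < N \<and> bj j v}))"
      using fJ0 fQ by (intro card_mono) auto
    also have "\<dots> \<le> card ?A + card (\<Union>v\<in>Q. {j. j < N \<and> bj j v})" by (rule card_Un_le)
    also have "card (\<Union>v\<in>Q. {j. j < N \<and> bj j v}) \<le> (\<Sum>v\<in>Q. card {j. j < N \<and> bj j v})" by (rule card_UN_le[OF fQ])
    finally have "real (card J0) \<le> real (card ?A + (\<Sum>v\<in>Q. card {j. j < N \<and> bj j v}))" by (simp only: of_nat_le_iff)
    also have "\<dots> = real (card ?A) + (\<Sum>v\<in>Q. real (card {j. j < N \<and> bj j v}))" by simp
    also have "(\<Sum>v\<in>Q. real (card {j. j < N \<and> bj j v})) \<le> (\<Sum>v\<in>Q. \<eta> * N)"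
      using bjW Q \<Q>(4) by (intro sum_mono) blast
    also have "\<dots> = (real r * \<eta>) * N" using \<Q>(5) Q by simp
    also have "\<dots> \<le> 1 / 100 * N" using \<eta>T'(2) by (intro mult_right_mono) auto
    finally have "real (card J0) \<le> real (card ?A) + N / 100" by simp
    moreover have "real (card J0) = real N - real (card Dd)" using cJ0 by linarith
    ultimately have "real s \<le> real (card ?A)" using cDd1 cs by linarith
    then show "card \<Q> \<le> card ?A" using \<Q>(2) by simp
  qed
  then obtain g where g: "inj_on g \<Q>" "\<And>Q. Q \<in> \<Q> \<Longrightarrow> g Q \<in> J0" "\<And>Q v. Q \<in> \<Q> \<Longrightarrow> v \<in> Q \<Longrightarrow> \<not> bj (g Q) v"
    by blast
  \<comment> \<open>blocks in \<open>Sg\<close> are enlarged by an \<open>r\<close>-subset of \<open>W\<close>, blocks in \<open>J\<close> absorb a spare colour\<close>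
  define Sg where "Sg = g ` \<Q>"
  define J where "J = J0 - Sg"
  define q where "q j = inv_into \<Q> g j" for j
  have qS: "q j \<in> \<Q>" "g (q j) = j" if "j \<in> Sg" for j
    using that unfolding q_def Sg_def by (auto intro: inv_into_into f_inv_into_f)
  have SgJ0: "Sg \<subseteq> J0" using g(2) by (auto simp: Sg_def)
  have cSg: "card Sg = s" using g(1) \<Q>(2) by (simp add: Sg_def card_image)
  have fSg: "finite Sg" and fJ: "finite J" using \<Q>(1) fJ0 by (auto simp: Sg_def J_def)
  define t where "t = card J"
  have cJ: "card J0 = s + t" using cSg SgJ0 fSg card_mono[OF fJ0 SgJ0] by (simp add: t_def J_def card_Diff_subset)
  have tN: "real N / 2 \<le> real t"
  proof -
    have "real s + real t + real (card Dd) = real N" using cJ cJ0 by linarith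
    then show ?thesis using cs cDd1 by linarith
  qed

  define Y where "Y j = U j \<union> (if j \<in> Sg then q j else {})" for j
  have qW: "q j \<subseteq> W" "finite (q j)" "card (q j) = r" "q j \<noteq> {}" if "j \<in> Sg" for j
  proof -
    show "q j \<subseteq> W" using qS(1)[OF that] \<Q>(4) by blast
    then show "finite (q j)" using fW finite_subset by blast
    show "card (q j) = r" using qS(1)[OF that] \<Q>(5) by blast
    then show "q j \<noteq> {}" using r_pos by auto
  qed
  have qU: "q j \<inter> U i = {}" if "j \<in> Sg" "i \<in> J0" for i j
    using qW(1)[OF that(1)] that(2) by (auto simp: W_def UJ_def)
  have fY: "finite (Y j)" if "j \<in> J0" for j using fU[OF J0N[OF that]] qW(2) by (auto simp: Y_def)
  have cY1: "card (Y j) = Suc T * r" if "j \<in> Sg" for j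
  proof -
    have "j \<in> J0" using that SgJ0 by blast
    then have "card (U j \<union> q j) = card (U j) + card (q j)"
      using fU J0N qW(2)[OF that] qU[OF that, of j] by (intro card_Un_disjoint) auto
    then show ?thesis using that U(2)[OF J0N[OF \<open>j \<in> J0\<close>]] qW(3)[OF that] by (simp add: Y_def mult.commute)
  qed
  have cY2: "card (Y j) = T * r" "Y j = U j" if "j \<in> J" for j
    using that U(2) J0N by (auto simp: J_def Y_def)
  have disY: "disjoint_family_on Y J0"
    unfolding disjoint_family_on_def
  proof (intro ballI impI)
    fix i j assume ij: "i \<in> J0" "j \<in> J0" "i \<noteq> j"
    have 1: "U i \<inter> U j = {}" using ij U(3) J0N by (auto simp: disjoint_family_on_def)
    have 2: "q i \<inter> q j = {}" if "i \<in> Sg" "j \<in> Sg"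
    proof -
      have "q i \<noteq> q j" using qS(2) that ij(3) by metis
      then show ?thesis using \<Q>(3) qS(1)[OF that(1)] qS(1)[OF that(2)] by (meson disjointD)
    qed
    show "Y i \<inter> Y j = {}" using 1 2 qU[of i j] qU[of j i] ij by (auto simp: Y_def)
  qed

  \<comment> \<open>Neighbours are counted in the original block \<open>U j\<close> even where
    \<open>Y j\<close> is larger, because the random choice controls only those.\<close>
  define ok where "ok i j \<longleftrightarrow> (\<forall>v\<in>Y j. s0 \<le> real (card (nbh (E i) v \<inter> U j)))" for i j
  have okpb: "ok i j \<longleftrightarrow> \<not> pb i j" if "j \<in> J" for i j
    using cY2(2)[OF that] by (auto simp: ok_def pb_def not_less)
  have nok: "real (card {i. i < n \<and> \<not> ok i j}) \<le> N / 50" if j: "j \<in> J0" for j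
  proof (cases "j \<in> Sg")
    case False
    then have "j \<in> J" using j by (simp add: J_def)
    then have "real (card {i. i < n \<and> \<not> ok i j}) = real (card {i. i < n \<and> pb i j})" using okpb by simp
    also have "\<dots> \<le> a" using j unfolding J0_def Dd_def Eb_def a_def by auto
    finally show ?thesis using ra1 by linarith
  next
    case True
    \<comment> \<open>A poor vertex of \<open>U j\<close> makes the triple with any vertex of
      \<open>q j\<close> deficient, so deficiency at the vertices of \<open>q j\<close> catches both
      cases.\<close>
    have "{i. i < n \<and> \<not> ok i j} \<subseteq> (\<Union>v\<in>q j. {i. i < n \<and> df i j v})"
    proof
      fix i assume i: "i \<in> {i. i < n \<and> \<not> ok i j}"
      then obtain v where v: "v \<in> Y j" "real (card (nbh (E i) v \<inter> U j)) < s0" by (auto simp: ok_def not_le)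
      obtain v' where v': "v' \<in> q j" using qW(4)[OF True] by blast
      show "i \<in> (\<Union>v\<in>q j. {i. i < n \<and> df i j v})"
      proof (cases "v \<in> q j")
        case True
        then show ?thesis using i v by (auto simp: df_def deficient_def)
      next
        case False
        then have "v \<in> U j" using v by (auto simp: Y_def split: if_splits)
        then have "pb i j" using v by (auto simp: pb_def)
        then show ?thesis using pbdf i v' by auto
      qed
    qed
    then have "card {i. i < n \<and> \<not> ok i j} \<le> card (\<Union>v\<in>q j. {i. i < n \<and> df i j v})"
      using qW(2)[OF True] by (intro card_mono) auto
    also have "\<dots> \<le> (\<Sum>v\<in>q j. card {i. i < n \<and> df i j v})" by (rule card_UN_le[OF qW(2)[OF True]])
    finally have "real (card {i. i < n \<and> \<not> ok i j}) \<le> real (\<Sum>v\<in>q j. card {i. i < n \<and> df i j v})"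
      by (simp only: of_nat_le_iff)
    also have "\<dots> = (\<Sum>v\<in>q j. real (card {i. i < n \<and> df i j v}))" by simp
    also have "\<dots> \<le> (\<Sum>v\<in>q j. a)"
    proof (rule sum_mono)
      fix v assume "v \<in> q j"
      then have "\<not> bj j v" using g(3)[OF qS(1)[OF True]] qS(2)[OF True] by simp
      then show "real (card {i. i < n \<and> df i j v}) \<le> a" by (simp add: bj_def a_def)
    qed
    also have "\<dots> = real r * a" using qW(3)[OF True] by simp
    finally show ?thesis using ra1 by linarith
  qed

  \<comment> \<open>With these sizes exactly \<open>t = card J\<close> colours remain, one for each
    place left open; \<open>sumd\<close> derives this from \<open>sn\<close>.\<close>
  define d where "d j = (if j \<in> Sg then Suc T else T - 1)" for j
  define P where "P j D \<longleftrightarrow> (\<forall>i\<in>D. ok i j) \<and> (\<forall>i\<in>D. \<forall>i'\<in>D. E i \<inter> Pow (Y j) = E i' \<inter> Pow (Y j))" for j D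
  define C' where "C' = {..<n} - C"
  have cC': "card C' = n - card C" using C(2) fC by (simp add: C'_def card_Diff_subset)
  have sumd: "sum d J0 + t = card C'"
  proof -
    have "sum d J0 = sum d Sg + sum d J"
      unfolding J_def using sum.subset_diff[OF SgJ0 fJ0, of d] by simp
    also have "sum d Sg = s * Suc T" using cSg by (simp add: d_def)
    also have "sum d J = (\<Sum>j\<in>J. T - 1)" by (rule sum.cong) (auto simp: d_def J_def)
    also have "\<dots> = t * (T - 1)" by (simp add: t_def)
    finally have "sum d J0 + t = s * Suc T + t * (T - 1) + t" by simp
    also have "t * (T - 1) + t = t * T" using T(1) by (cases T) auto
    then have "s * Suc T + t * (T - 1) + t = s + (s + t) * T" by (simp add: algebra_simps)
    also have "\<dots> = n - card C" using sn cJ by simp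
    finally show ?thesis using cC' by simp
  qed
  have "\<exists>D. (\<forall>j\<in>J0. D j \<subseteq> C' \<and> card (D j) = d j \<and> P j (D j)) \<and> disjoint_family_on D J0"
  proof (rule greedy_disjoint_subsets[OF fJ0])
    show "finite C'" by (simp add: C'_def)
    show "sum d J0 + t \<le> card C'" using sumd by simp
    fix j R assume j: "j \<in> J0" and R: "R \<subseteq> C'" "t \<le> card R"
    have fR: "finite R" using R(1) finite_subset[of R "{..<n}"] by (auto simp: C'_def)
    define R' where "R' = {i \<in> R. ok i j}"
    have "R \<subseteq> R' \<union> {i. i < n \<and> \<not> ok i j}" using R(1) by (auto simp: R'_def C'_def)
    then have "card R \<le> card (R' \<union> {i. i < n \<and> \<not> ok i j})" using fR by (intro card_mono) (auto simp: R'_def)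
    also have "\<dots> \<le> card R' + card {i. i < n \<and> \<not> ok i j}" by (rule card_Un_le)
    finally have "real t \<le> real (card R') + real (card {i. i < n \<and> \<not> ok i j})" using R(2) by linarith
    then have R'N: "real N / 4 \<le> real (card R')" using nok[OF j] tN by linarith
    \<comment> \<open>Induced graphs are counted crudely as arbitrary families of subsets of
      \<open>Y j\<close>, whence the double exponential in the demand on \<open>N\<close>. The
      reserve \<open>t\<close> leaves at least \<open>N / 4\<close> suitable colours, more than this
      product.\<close>
    have "card (Pow (Pow (Y j))) * d j \<le> 2 ^ 2 ^ (r * (T + 1)) * (T + 1)"
    proof (rule mult_le_mono)
      have "card (Y j) \<le> r * (T + 1)"
        using cY1[of j] cY2(1)[of j] j by (cases "j \<in> Sg") (auto simp: J_def algebra_simps)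
      then show "card (Pow (Pow (Y j))) \<le> 2 ^ 2 ^ (r * (T + 1))"
        using fY[OF j] by (simp add: card_Pow)
      show "d j \<le> T + 1" by (simp add: d_def le_diff_conv)
    qed
    then have "4 * (card (Pow (Pow (Y j))) * d j) < N" using N(3) by linarith
    then have "card (Pow (Pow (Y j))) * d j < card R'" using R'N by linarith
    moreover have "finite R'" "finite (Pow (Pow (Y j)))" "(\<lambda>i. E i \<inter> Pow (Y j)) ` R' \<subseteq> Pow (Pow (Y j))"
      using fR fY[OF j] by (auto simp: R'_def)
    ultimately have "\<exists>D\<subseteq>R'. card D = d j \<and> (\<forall>i\<in>D. \<forall>i'\<in>D. E i \<inter> Pow (Y j) = E i' \<inter> Pow (Y j))"
      by (intro pigeonhole_fibre)
    then obtain D where D: "D \<subseteq> R'" "card D = d j" and same: "\<forall>i\<in>D. \<forall>i'\<in>D. E i \<inter> Pow (Y j) = E i' \<inter> Pow (Y j)"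
      by (elim exE conjE)
    have "D \<subseteq> R" and okD: "\<forall>i\<in>D. ok i j" using D(1) by (auto simp: R'_def)
    moreover have "P j D" unfolding P_def by (rule conjI[OF okD same])
    ultimately show "\<exists>D\<subseteq>R. card D = d j \<and> P j D" using D(2) by (intro exI[of _ D] conjI)
  qed
  then obtain D where D: "\<And>j. j \<in> J0 \<Longrightarrow> D j \<subseteq> C'" "\<And>j. j \<in> J0 \<Longrightarrow> card (D j) = d j"
    "\<And>j. j \<in> J0 \<Longrightarrow> P j (D j)" "disjoint_family_on D J0" by blast
  have fC': "finite C'" by (simp add: C'_def)
  have fD: "finite (D j)" if "j \<in> J0" for j using D(1)[OF that] fC' finite_subset by blast
  define X where "X = C' - (\<Union>j\<in>J0. D j)"
  have fX: "finite X" using fC' by (simp add: X_def)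
  have cX: "card X = t"
  proof -
    have "card (\<Union>j\<in>J0. D j) = (\<Sum>j\<in>J0. card (D j))"
      using fJ0 fD D(4) by (intro card_UN_disjoint) (auto simp: disjoint_family_on_def)
    also have "\<dots> = sum d J0" using D(2) by simp
    finally have "card (\<Union>j\<in>J0. D j) = sum d J0" .
    moreover have "card X = card C' - card (\<Union>j\<in>J0. D j)"
      unfolding X_def using D(1) fD fJ0 by (intro card_Diff_subset) auto
    ultimately show ?thesis using sumd by simp
  qed
  \<comment> \<open>Spare colours are not exceptional because \<open>Ec\<close> lies in
    \<open>C\<close>, and blocks of \<open>J\<close> are not because \<open>Eb\<close> was
    dissolved. So there are at most \<open>N / 50\<close> non-neighbours on either side, while both
    sides have size \<open>t \<ge> N / 2\<close>.\<close>
  have "\<exists>h. bij_betw h X J \<and> (\<forall>x\<in>X. ok x (h x))"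
  proof (rule bij_betw_of_few_nonneighbours[OF fX fJ])
    show "card X = card J" using cX by (simp add: t_def)
    fix x assume x: "x \<in> X"
    then have "x < n" "x \<notin> Ec" using C(1) by (auto simp: X_def C'_def)
    then have "real (card {j. j < N \<and> pb x j}) \<le> \<eta> * N" by (simp add: Ec_def not_less)
    also have "\<dots> \<le> 1 / 100 * N" using \<eta>T'(3) by (intro mult_right_mono) auto
    finally have 1: "real (card {j. j < N \<and> pb x j}) \<le> 1 / 100 * N" .
    have "card {j \<in> J. \<not> ok x j} \<le> card {j. j < N \<and> pb x j}"
      using okpb J0N by (intro card_mono) (auto simp: J_def)
    then have "2 * real (card {j \<in> J. \<not> ok x j}) < real t" using 1 tN N0 by linarith
    then show "2 * card {j \<in> J. \<not> ok x j} < card X" using cX by linarith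
  next
    fix j assume j: "j \<in> J"
    have "card {x \<in> X. \<not> ok x j} \<le> card {i. i < n \<and> \<not> ok i j}"
      by (intro card_mono) (auto simp: X_def C'_def)
    moreover have "real (card {i. i < n \<and> \<not> ok i j}) \<le> N / 50" using nok j by (auto simp: J_def)
    ultimately have "2 * real (card {x \<in> X. \<not> ok x j}) < real t" using tN N0 by linarith
    then show "2 * card {x \<in> X. \<not> ok x j} < card X" using cX by linarith
  qed
  then obtain h where h: "bij_betw h X J" "\<And>x. x \<in> X \<Longrightarrow> ok x (h x)" by blast
  define y where "y = inv_into X h"
  have y: "y j \<in> X" "h (y j) = j" if "j \<in> J" for j
    using h(1) that unfolding y_def bij_betw_def by (auto intro: inv_into_into f_inv_into_f)

  define Cf where "Cf j = D j \<union> (if j \<in> J then {y j} else {})" for j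
  have CfU: "(\<Union>j\<in>J0. Cf j) = C'"
  proof
    show "(\<Union>j\<in>J0. Cf j) \<subseteq> C'" using D(1) y(1) by (auto simp: Cf_def X_def split: if_splits)
    show "C' \<subseteq> (\<Union>j\<in>J0. Cf j)"
    proof
      fix i assume i: "i \<in> C'"
      show "i \<in> (\<Union>j\<in>J0. Cf j)"
      proof (cases "i \<in> X")
        case True
        then have "h i \<in> J" "y (h i) = i" using h(1) by (auto simp: y_def bij_betw_def)
        then show ?thesis by (auto simp: Cf_def J_def intro!: bexI[of _ "h i"])
      next
        case False
        then show ?thesis using i by (auto simp: X_def Cf_def)
      qed
    qed
  qed
  have Cfdis: "disjoint_family_on Cf J0"
    unfolding disjoint_family_on_def
  proof (intro ballI impI)
    fix i j assume ij: "i \<in> J0" "j \<in> J0" "i \<noteq> j"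
    have 1: "D i \<inter> D j = {}" using ij D(4) by (auto simp: disjoint_family_on_def)
    have 2: "y i' \<notin> D j'" if "i' \<in> J" "j' \<in> J0" for i' j' using y(1)[OF that(1)] that(2) by (auto simp: X_def)
    have 3: "y i \<noteq> y j" if "i \<in> J" "j \<in> J" using y(2) that ij(3) by metis
    show "Cf i \<inter> Cf j = {}" using 1 2 3 ij by (auto simp: Cf_def)
  qed
  have C'n: "i < n" if "i \<in> C'" for i using that by (simp add: C'_def)
  have s0T: "s0 = c * real (r * T) + 2 * k * T * r" by (simp add: s0_def algebra_simps)
  have sameD: "E i \<inter> Pow (Y j) = E i' \<inter> Pow (Y j)" if "j \<in> J0" "i \<in> D j" "i' \<in> D j" for i i' j
    by (rule bspec[OF bspec[OF conjunct2[OF D(3)[OF that(1), unfolded P_def]] that(2)] that(3)])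
  have okD: "ok i j" if "j \<in> J0" "i \<in> D j" for i j
    using conjunct1[OF D(3)[OF that(1), unfolded P_def]] that(2) by (rule bspec)
  have asgJ: "assignable E (Cf j) (Y j)" if j: "j \<in> J0" for j
  proof (cases "j \<in> Sg")
    case True
    then have Cfj: "Cf j = D j" by (simp add: Cf_def J_def)
    show ?thesis
      unfolding Cfj
    proof (rule assignable_same_induced[OF fY[OF j] cY1[OF True] _ fD[OF j]])
      show "M \<le> Suc T * r" using T(2) by (metis diff_le_self le_SucI le_trans mult_le_mono1)
      show "card (D j) = Suc T" using D(2)[OF j] True by (simp add: d_def)
      fix i v assume i: "i \<in> D j"
      show "card e = 2" if "e \<in> E i" for e using simple[OF C'n that] D(1)[OF j] i by blast
      assume v: "v \<in> Y j"
      have "s0 \<le> card (nbh (E i) v \<inter> U j)" using okD[OF j i] v by (auto simp: ok_def)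
      moreover have "card (nbh (E i) v \<inter> U j) \<le> card (nbh (E i) v \<inter> Y j)"
        using fY[OF j] by (intro card_mono) (auto simp: Y_def)
      \<comment> \<open>The enlarged block demands \<open>c * r\<close> further neighbours; the
        surplus \<open>2 * k * T * r\<close> contained in \<open>s0\<close> pays for them.\<close>
      moreover have "c * r \<le> 2 * k * T * r" using T(4) by (intro mult_right_mono) auto
      moreover have "c * card (Y j) = c * real (r * T) + c * r" using cY1[OF True] by (simp add: algebra_simps)
      ultimately show "c * card (Y j) \<le> card (nbh (E i) v \<inter> Y j)" using s0T by linarith
    next
      fix i i' assume "i \<in> D j" "i' \<in> D j"
      then show "E i \<inter> Pow (Y j) = E i' \<inter> Pow (Y j)" by (rule sameD[OF j])
    qed
  next
    case False
    then have jJ: "j \<in> J" using j by (simp add: J_def)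
    then have Cfj: "Cf j = insert (y j) (D j)" by (simp add: Cf_def)
    have yj: "ok (y j) j" using h(2)[OF y(1)[OF jJ]] y(2)[OF jJ] by simp
    have yC: "y j \<in> C'" "y j \<notin> D j" using y(1)[OF jJ] j by (auto simp: X_def)
    show ?thesis
      unfolding Cfj
    proof (rule assignable_absorb[OF fY[OF j] _ T(2) fD[OF j] _ yC(2)])
      show "card (Y j) = Suc (T - 1) * r" using cY2(1)[OF jJ] T(1) by simp
      show "card (D j) = T - 1" using D(2)[OF j] False by (simp add: d_def)
      fix i v assume i: "i \<in> insert (y j) (D j)"
      show "card e = 2" if "e \<in> E i" for e using simple[OF C'n that] D(1)[OF j] i yC by blast
      assume v: "v \<in> Y j"
      have "ok i j" using okD[OF j] i yj by auto
      then have "s0 \<le> card (nbh (E i) v \<inter> Y j)" using v cY2(2)[OF jJ] by (auto simp: ok_def)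
      \<comment> \<open>Here the same surplus pays for the \<open>r\<close> neighbours that may be
        lost with the absorbed copy.\<close>
      moreover have "1 * real r \<le> 2 * k * T * r" using T(3) by (intro mult_right_mono) auto
      moreover have "c * card (Y j) = c * real (r * T)" using cY2(1)[OF jJ] by (simp add: mult.commute)
      ultimately show "c * card (Y j) + r \<le> card (nbh (E i) v \<inter> Y j)" using s0T by linarith
    next
      fix i i' assume "i \<in> D j" "i' \<in> D j"
      then show "E i \<inter> Pow (Y j) = E i' \<inter> Pow (Y j)" by (rule sameD[OF j])
    qed
  qed
  have "assignable E C' (\<Union>j\<in>J0. Y j)"
    using assignable_UN[OF Cfdis disY asgJ] CfU by simp
  moreover have "Z \<inter> (\<Union>j\<in>J0. Y j) = {}"
  proof -
    have "U j \<inter> Z = {}" if "j \<in> J0" for j using UJZ that by (auto simp: UJ_def)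
    moreover have "q j \<inter> Z = {}" if "j \<in> Sg" for j using qW(1)[OF that] by (auto simp: W_def)
    ultimately have "Z \<inter> Y j = {}" if "j \<in> J0" for j using that by (auto simp: Y_def)
    then show ?thesis by blast
  qed
  moreover have "C \<inter> C' = {}" by (auto simp: C'_def)
  ultimately have "assignable E (C \<union> C') (Z \<union> (\<Union>j\<in>J0. Y j))" using asgC by (intro assignable_Un) auto
  moreover have "C \<union> C' = {..<n}" using C(2) by (auto simp: C'_def)
  moreover have "Z \<union> (\<Union>j\<in>J0. Y j) \<subseteq> V"
  proof -
    have "Y j \<subseteq> V" if "j \<in> J0" for j
      using U(1)[OF J0N[OF that]] qW(1)[of j] by (cases "j \<in> Sg") (auto simp: Y_def W_def)
    then show ?thesis using ZV by blast
  qed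
  ultimately show ?thesis using assignable_mono by metis
qed

text \<open>The block size depends on \<open>k\<close>, \<open>r\<close>, \<open>M\<close> and
  \<open>c\<close> alone, so the doubly exponential demand on \<open>N\<close> is just another
  constant by the time \<open>n\<close> is chosen.\<close>

theorem eventually_assignable:
  fixes k :: real
  assumes k: "0 < k"
  shows "\<exists>n0. \<forall>n\<ge>n0. \<forall>V (E :: nat \<Rightarrow> 'a set set).
    finite V \<and> card V = r * n \<and> (\<forall>i<n. \<forall>e\<in>E i. card e = 2) \<and>
    (\<forall>i<n. \<forall>v\<in>V. nbh (E i) v \<subseteq> V \<and> (c + 3 * k) * real (r * n) \<le> card (nbh (E i) v)) \<longrightarrow>
    assignable E {..<n} V"
proof -
  have "0 < real r" using r_pos by simp
  note eventually_exp_dominates[OF k this]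
  moreover have "eventually (\<lambda>T :: nat. M + 1 \<le> T) at_top" by (rule eventually_ge_at_top)
  moreover have "eventually (\<lambda>T :: nat. nat \<lceil>1 / (2 * k)\<rceil> \<le> T) at_top" by (rule eventually_ge_at_top)
  moreover have "eventually (\<lambda>T :: nat. nat \<lceil>c / (2 * k)\<rceil> \<le> T) at_top" by (rule eventually_ge_at_top)
  ultimately have "eventually (\<lambda>T :: nat. 2 * (real r * T * exp 1 + 1) * exp (- (k\<^sup>2 * (real r * T) / 2))
      * (100 * (real r)\<^sup>2 * (real T)\<^sup>2) ^ 3 \<le> 1 \<and> M + 1 \<le> T \<and> 1 / (2 * k) \<le> T \<and> c / (2 * k) \<le> T) at_top"
    by eventually_elim (auto simp: nat_le_iff ceiling_le_iff)
  then obtain T :: nat where T1: "2 * (real r * T * exp 1 + 1) * exp (- (k\<^sup>2 * (real r * T) / 2))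
      * (100 * (real r)\<^sup>2 * (real T)\<^sup>2) ^ 3 \<le> 1"
    and T2: "M + 1 \<le> T" and T3: "1 / (2 * k) \<le> T" "c / (2 * k) \<le> T"
    by (auto dest!: eventually_happens)
  define \<eta> where "\<eta> = 1 / (100 * (real r)\<^sup>2 * (real T)\<^sup>2)"
  have T0: "0 < T" using T2 by simp
  have TM: "M \<le> (T - 1) * r"
  proof -
    have "M * 1 \<le> (T - 1) * r" using T2 r_pos by (intro mult_le_mono) auto
    then show ?thesis by simp
  qed
  have Tk: "1 \<le> 2 * k * T" "c \<le> 2 * k * T" using T3 k by (auto simp: field_simps)
  have pos: "0 < (100 * (real r)\<^sup>2 * (real T)\<^sup>2) ^ 3" using r_pos T0 by simp
  have \<theta>: "2 * (real (r * T) * exp 1 + 1) * exp (- (k\<^sup>2 * real (r * T) / 2)) \<le> \<eta> ^ 3"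
  proof -
    have "2 * (real r * T * exp 1 + 1) * exp (- (k\<^sup>2 * (real r * T) / 2)) \<le> 1 / (100 * (real r)\<^sup>2 * (real T)\<^sup>2) ^ 3"
      using T1 pos by (subst pos_le_divide_eq) auto
    then show ?thesis unfolding \<eta>_def power_one_over[symmetric] by (simp add: power_divide)
  qed
  \<comment> \<open>Each summand serves one of the lower bounds that the choice of blocks and the
    assembly put on \<open>N\<close>, \<open>n\<close> or \<open>card V\<close>;
    \<open>K * T \<le> n\<close> gives \<open>K \<le> N\<close>.\<close>
  define K where "K = 100 * T + 4 * (2 ^ 2 ^ (r * (T + 1)) * (T + 1)) + 1 + 2 * M + 2 * (r * T)\<^sup>2"
  show ?thesis
  proof (intro exI[of _ "K * T"] allI impI, elim conjE)
    fix n V and E :: "nat \<Rightarrow> 'a set set"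
    assume n: "K * T \<le> n" and V: "finite V" "card V = r * n" and simple: "\<forall>i<n. \<forall>e\<in>E i. card e = 2"
      and dg: "\<forall>i<n. \<forall>v\<in>V. nbh (E i) v \<subseteq> V \<and> (c + 3 * k) * real (r * n) \<le> card (nbh (E i) v)"
    define N where "N = n div T"
    have NK: "K \<le> N" using n T0 unfolding N_def by (metis div_le_mono div_mult_self_is_m)
    have "K * 1 \<le> K * T" using T0 by (intro mult_le_mono2) simp
    then have nK: "K \<le> n" using n by linarith
    then have n0: "0 < n" by (simp add: K_def)
    have rn: "0 < real (r * n)" using r_pos n0 by simp
    \<comment> \<open>A degree cannot exceed \<open>card V\<close>, so the hypotheses themselves
      force \<open>c + 3 * k \<le> 1\<close>, as the tail bound requires.\<close>
    obtain v where v: "v \<in> V" using V r_pos n0 by fastforce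
    have "card (nbh (E 0) v) \<le> r * n" using dg v n0 V by (metis card_mono)
    moreover have "(c + 3 * k) * real (r * n) \<le> card (nbh (E 0) v)" using dg v n0 by blast
    ultimately have "(c + 3 * k) * real (r * n) \<le> 1 * real (r * n)" by linarith
    then have c1: "c + 3 * k \<le> 1" using rn by (simp only: mult_le_cancel_right)
    then have k1: "k \<le> 1" using c_nonneg k by linarith
    have m0: "0 < r * T" using r_pos T0 by simp
    have nr: "n \<le> r * n" using r_pos by simp
    have m2: "2 * (r * T)\<^sup>2 \<le> card V" using nK nr unfolding V(2) K_def by linarith
    have "r * (T * N) \<le> r * n" unfolding N_def by (intro mult_le_mono2) simp
    then have Nm: "N * (r * T) \<le> card V" using V(2) by (simp add: mult_ac)
    have nb: "nbh (E i) v \<subseteq> V" and deg: "(c + 3 * k) * real (r * n) \<le> card (nbh (E i) v)"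
      if "i < n" "v \<in> V" for i v using dg that by blast+
    have deg': "(c + 3 * k) * real (card V) \<le> card (nbh (E i) v)" if "i < n" "v \<in> V" for i v
      using deg[OF that] V(2) by simp
    have "\<exists>U. (\<forall>j<N. U j \<subseteq> V \<and> card (U j) = r * T) \<and> disjoint_family_on U {..<N} \<and>
      real (card {(i, j, v) \<in> {..<n} \<times> {..<N} \<times> V. deficient (E i) ((c + 2 * k) * real (r * T)) (U j) v})
        \<le> \<eta> ^ 3 * (real n * real N * real (card V))"
      by (rule exists_blocks_few_deficient[OF V(1) k k1 c_nonneg c1 m0 m2 Nm _ _ \<theta>]) (rule nb deg'; assumption)+
    then obtain U where U: "\<forall>j<N. U j \<subseteq> V \<and> card (U j) = r * T" "disjoint_family_on U {..<N}"
      "real (card {(i, j, v) \<in> {..<n} \<times> {..<N} \<times> V. deficient (E i) ((c + 2 * k) * real (r * T)) (U j) v})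
        \<le> \<eta> ^ 3 * (real n * real N * real (card V))"
      by (elim exE conjE)
    show "assignable E {..<n} V"
    proof (rule assignable_of_blocks[OF V deg nb _ k T0 TM Tk \<eta>_def N_def])
      show "card e = 2" if "i < n" "e \<in> E i" for i e using simple that by blast
      show "100 * T \<le> N" "4 * (2 ^ 2 ^ (r * (T + 1)) * (T + 1)) < N" "2 * M \<le> n"
        using NK nK unfolding K_def by linarith+
    qed (use U in auto)
  qed
qed

end

section \<open>Back from abstract tilings to graphs and the factor threshold\<close>

definition copy_on :: "'a ugraph \<Rightarrow> 'b set set \<Rightarrow> 'b set \<Rightarrow> bool" where
  "copy_on F E S \<longleftrightarrow> (\<exists>H. simple_graph H \<and> verts H = S \<and> edges H \<subseteq> E \<and> graph_iso F H)"

lemma vdegree_eq_card_nbh: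
  assumes "\<And>e. e \<in> edges G \<Longrightarrow> card e = 2"
  shows "vdegree G v = card (nbh (edges G) v)"
proof -
  have "bij_betw (\<lambda>u. {u, v}) (nbh (edges G) v) {e \<in> edges G. v \<in> e}"
    unfolding bij_betw_def
  proof
    show "inj_on (\<lambda>u. {u, v}) (nbh (edges G) v)" by (auto simp: inj_on_def doubleton_eq_iff)
    show "(\<lambda>u. {u, v}) ` nbh (edges G) v = {e \<in> edges G. v \<in> e}"
    proof (intro equalityI subsetI)
      fix e assume e: "e \<in> {e \<in> edges G. v \<in> e}"
      then have "card e = 2" using assms by blast
      then obtain x y where "e = {x, y}" unfolding card_2_iff by blast
      then have "e = {x, v} \<or> e = {y, v}" using e by auto
      then show "e \<in> (\<lambda>u. {u, v}) ` nbh (edges G) v" using e by (auto simp: nbh_def)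
    qed (auto simp: nbh_def)
  qed
  then show ?thesis unfolding vdegree_def by (rule bij_betw_same_card[symmetric])
qed

text \<open>\<open>factor_bound\<close> promises factors only for degrees above the threshold by a
  fixed proportion, so the locale is entered with \<open>factor_threshold F + k\<close>.\<close>

lemma tiling_copy_on:
  fixes F :: "'a ugraph" and k :: real
  assumes F: "simple_graph F" "edges F \<noteq> {}" and k: "0 < k"
  shows "\<exists>M. tiling (copy_on F :: nat set set \<Rightarrow> nat set \<Rightarrow> bool) (card (verts F)) M (factor_threshold F + k)"
proof -
  let ?c = "factor_threshold F + k"
  have fb: "factor_bound F (factor_threshold F)" using factor_threshold_least[OF F] by blast
  then obtain n0 where n0: "\<And>n (G :: nat ugraph). n \<ge> n0 \<Longrightarrow> card (verts F) dvd n \<Longrightarrow>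
      simple_graph G \<Longrightarrow> card (verts G) = n \<Longrightarrow> real (min_degree G) \<ge> ?c * real n \<Longrightarrow> has_factor F G"
    using k unfolding factor_bound_def by blast
  \<comment> \<open>\<open>Suc n0\<close> keeps \<open>M\<close> positive, so that \<open>U\<close>
    is nonempty and its minimum degree is attained.\<close>
  have "tiling (copy_on F :: nat set set \<Rightarrow> nat set \<Rightarrow> bool) (card (verts F)) (Suc n0) ?c"
  proof
    obtain e where "e \<in> edges F" using F by blast
    then have "e \<subseteq> verts F" "e \<noteq> {}" using F by (auto simp: simple_graph_def)
    then show "0 < card (verts F)" using F by (auto simp: simple_graph_def card_gt_0_iff)
    show "0 \<le> ?c" using factor_bound_nonneg[OF F fb] k by linarith
  next
    fix E and S :: "nat set"
    assume c: "copy_on F E S"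
    then obtain H where H: "simple_graph H" "verts H = S" "edges H \<subseteq> E" "graph_iso F H"
      unfolding copy_on_def by blast
    then show "finite S \<and> card S = card (verts F)"
      unfolding simple_graph_def graph_iso_def by (metis bij_betw_same_card)
    fix E' assume "E \<inter> Pow S \<subseteq> E'"
    moreover have "edges H \<subseteq> Pow S" using H(1,2) by (auto simp: simple_graph_def)
    ultimately show "copy_on F E' S" using H unfolding copy_on_def by blast
  next
    fix U :: "nat set" and E
    assume U: "finite U" "Suc n0 \<le> card U" "card (verts F) dvd card U" and E: "\<forall>e\<in>E. card e = 2"
      and deg: "\<forall>v\<in>U. ?c * real (card U) \<le> real (card (nbh E v \<inter> U))"
    define G where "G = (U, E \<inter> Pow U)"
    have sG: "simple_graph G" using U E by (auto simp: G_def simple_graph_def)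
    have "vdegree G v = card (nbh E v \<inter> U)" if "v \<in> U" for v
    proof -
      have "vdegree G v = card (nbh (edges G) v)" using E by (intro vdegree_eq_card_nbh) (auto simp: G_def)
      also have "nbh (edges G) v = nbh E v \<inter> U" using that by (auto simp: nbh_def G_def)
      finally show ?thesis .
    qed
    moreover have "min_degree G \<in> vdegree G ` U"
      unfolding min_degree_def using U by (subst fst_conv[of U "E \<inter> Pow U", folded G_def])+ (auto intro!: Min_in)
    ultimately have "?c * real (card U) \<le> real (min_degree G)" using deg by auto
    then have "has_factor F G" using n0[of "card U" G] U sG by (auto simp: G_def)
    then obtain \<H> where \<H>: "\<forall>H\<in>\<H>. copy_in F H G" "pairwise (\<lambda>H H'. verts H \<inter> verts H' = {}) \<H>"
      "(\<Union>H\<in>\<H>. verts H) = verts G" unfolding has_factor_def by blast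
    have "disjoint (verts ` \<H>)"
    proof (rule disjointI)
      fix A B assume AB: "A \<in> verts ` \<H>" "B \<in> verts ` \<H>" "A \<noteq> B"
      then obtain H H' where "H \<in> \<H>" "H' \<in> \<H>" "A = verts H" "B = verts H'" by blast
      then show "A \<inter> B = {}" using AB(3) pairwiseD[OF \<H>(2), of H H'] by blast
    qed
    moreover have "\<Union>(verts ` \<H>) = U" using \<H>(3) by (simp add: G_def)
    moreover have "copy_on F E (verts H)" if "H \<in> \<H>" for H
      using \<H>(1) that unfolding copy_in_def subgraph_def copy_on_def G_def by (intro exI[of _ H]) auto
    ultimately show "\<exists>\<S>. disjoint \<S> \<and> \<Union>\<S> = U \<and> (\<forall>S\<in>\<S>. copy_on F E S)" by (intro exI[of _ "verts ` \<H>"]) auto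
  qed simp
  then show ?thesis by blast
qed

text \<open>Without edges \<open>factor_threshold F\<close> is unspecified, so the copies are built
  by hand on consecutive intervals. This case includes the empty graph, whereas an edge forces
  \<open>0 < r\<close> as the locale demands.\<close>

lemma edgeless_copies:
  fixes F :: "'a ugraph"
  assumes F: "simple_graph F" "card (verts F) = r" "edges F = {}"
    and G: "graph_collection {1..r * n} \<GG>" "length \<GG> = n"
  shows "\<exists>Fs :: nat ugraph list. length Fs = n \<and>
       (\<forall>i<n. copy_in F (Fs ! i) (\<GG> ! i)) \<and>
       (\<forall>i<n. \<forall>j<n. i \<noteq> j \<longrightarrow> verts (Fs ! i) \<inter> verts (Fs ! j) = {})"
proof -
  \<comment> \<open>Open on the left, as the vertices are numbered from 1.\<close>
  define S where "S i = {i * r<..Suc i * r}" for i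
  define Fs :: "nat ugraph list" where "Fs = map (\<lambda>i. (S i, {})) [0..<n]"
  have Fs: "Fs ! i = (S i, {})" if "i < n" for i using that by (simp add: Fs_def)
  have "copy_in F (Fs ! i) (\<GG> ! i)" if i: "i < n" for i
  proof -
    have "verts (\<GG> ! i) = {1..r * n}" using G i by (auto simp: graph_collection_def)
    moreover have "Suc i * r \<le> n * r" using i by (intro mult_le_mono1) simp
    then have "S i \<subseteq> {1..r * n}" by (auto simp: S_def mult.commute)
    moreover obtain f where "bij_betw f (verts F) (S i)"
      using F finite_same_card_bij[of "verts F" "S i"] by (auto simp: simple_graph_def S_def)
    ultimately show ?thesis
      using F Fs[OF i] unfolding copy_in_def subgraph_def graph_iso_def by (auto simp: simple_graph_def S_def)
  qed
  moreover have "S i \<inter> S j = {}" if "i < j" for i j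
  proof -
    have "Suc i * r \<le> j * r" using that by (intro mult_le_mono1) simp
    then show ?thesis by (auto simp: S_def)
  qed
  then have "S i \<inter> S j = {}" if "i \<noteq> j" for i j using that by (metis inf_commute nat_neq_iff)
  ultimately show ?thesis using Fs by (intro exI[of _ Fs]) (auto simp: Fs_def)
qed

theorem theorem1p3:
  fixes F :: "'a ugraph" and r :: nat and \<epsilon> :: real
  assumes "\<epsilon> > 0"
    and "simple_graph F" and "card (verts F) = r"
  shows "\<exists>n0 :: nat. \<forall>n\<ge>n0. \<forall>\<GG> :: nat ugraph list.
    graph_collection {1..r * n} \<GG> \<and> length \<GG> = n \<and>
    real (coll_min_degree \<GG>) \<ge> (factor_threshold F + \<epsilon>) * real r * real n \<longrightarrow>
    (\<exists>Fs :: nat ugraph list. length Fs = n \<and>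
       (\<forall>i<n. copy_in F (Fs ! i) (\<GG> ! i)) \<and>
       (\<forall>i<n. \<forall>j<n. i \<noteq> j \<longrightarrow> verts (Fs ! i) \<inter> verts (Fs ! j) = {}))"
proof (cases "edges F = {}")
  case True
  then show ?thesis using edgeless_copies[OF assms(2,3)] by blast
next
  case False
  \<comment> \<open>One part goes into the constant of the locale, three into the slack of
    \<open>eventually_assignable\<close>.\<close>
  define k where "k = \<epsilon> / 4"
  have k: "0 < k" using assms(1) by (simp add: k_def)
  obtain M where "tiling (copy_on F :: nat set set \<Rightarrow> nat set \<Rightarrow> bool) r M (factor_threshold F + k)"
    using tiling_copy_on[OF assms(2) False k] assms(3) by blast
  then interpret tiling "copy_on F :: nat set set \<Rightarrow> nat set \<Rightarrow> bool" r M "factor_threshold F + k" .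
  obtain n0 where n0: "\<forall>n\<ge>n0. \<forall>V (E :: nat \<Rightarrow> nat set set).
      finite V \<and> card V = r * n \<and> (\<forall>i<n. \<forall>e\<in>E i. card e = 2) \<and>
      (\<forall>i<n. \<forall>v\<in>V. nbh (E i) v \<subseteq> V \<and>
        (factor_threshold F + k + 3 * k) * real (r * n) \<le> card (nbh (E i) v)) \<longrightarrow>
      assignable E {..<n} V"
    by (rule exE[OF eventually_assignable[OF k]])
  show ?thesis
  proof (intro exI[of _ n0] allI impI, elim conjE)
    fix n and \<GG> :: "nat ugraph list"
    assume n: "n0 \<le> n" and G: "graph_collection {1..r * n} \<GG>" and len: "length \<GG> = n"
      and deg: "(factor_threshold F + \<epsilon>) * real r * real n \<le> real (coll_min_degree \<GG>)"
    define E where "E i = edges (\<GG> ! i)" for i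
    have sG: "simple_graph (\<GG> ! i)" and vG: "verts (\<GG> ! i) = {1..r * n}" if "i < n" for i
      using G that len by (auto simp: graph_collection_def)
    have E2: "card e = 2" "e \<subseteq> {1..r * n}" if "i < n" "e \<in> E i" for i e
      using sG[OF that(1)] vG[OF that(1)] that(2) by (auto simp: simple_graph_def E_def)
    have "assignable E {..<n} {1..r * n}"
    proof (rule n0[rule_format, OF n], intro conjI)
      show "\<forall>i<n. \<forall>v\<in>{1..r * n}. nbh (E i) v \<subseteq> {1..r * n} \<and>
          (factor_threshold F + k + 3 * k) * real (r * n) \<le> real (card (nbh (E i) v))"
      proof (intro allI impI ballI conjI)
        fix i v assume i: "i < n" and v: "v \<in> {1..r * n}"
        show "nbh (E i) v \<subseteq> {1..r * n}" using E2(2)[OF i] by (auto simp: nbh_def)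
        have "coll_min_degree \<GG> \<le> min_degree (\<GG> ! i)"
          unfolding coll_min_degree_def using i len by (intro Min_le) auto
        also have "\<dots> \<le> vdegree (\<GG> ! i) v"
          unfolding min_degree_def using v vG[OF i] by (intro Min_le) auto
        also have "\<dots> = card (nbh (E i) v)"
          unfolding E_def using E2(1)[OF i] by (intro vdegree_eq_card_nbh) (auto simp: E_def)
        finally have "real (coll_min_degree \<GG>) \<le> real (card (nbh (E i) v))" by simp
        moreover have "(factor_threshold F + k + 3 * k) * real (r * n) = (factor_threshold F + \<epsilon>) * real r * real n"
          by (simp add: k_def)
        ultimately show "(factor_threshold F + k + 3 * k) * real (r * n) \<le> real (card (nbh (E i) v))"
          using deg by linarith
      qed
    qed (use E2 in auto)
    then obtain f where f: "\<And>i. i < n \<Longrightarrow> copy_on F (E i) (f i) \<and> f i \<subseteq> {1..r * n}" "disjoint_family_on f {..<n}"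
      unfolding assignable_def by auto
    have "\<exists>H. copy_in F H (\<GG> ! i) \<and> verts H = f i" if "i < n" for i
      using f(1)[OF that] vG[OF that] unfolding copy_on_def copy_in_def subgraph_def E_def by (elim exE conjE) blast
    then obtain H where H: "\<And>i. i < n \<Longrightarrow> copy_in F (H i) (\<GG> ! i) \<and> verts (H i) = f i" by metis
    have "f i \<inter> f j = {}" if "i < n" "j < n" "i \<noteq> j" for i j
      using f(2) that by (auto simp: disjoint_family_on_def)
    then show "\<exists>Fs :: nat ugraph list. length Fs = n \<and> (\<forall>i<n. copy_in F (Fs ! i) (\<GG> ! i)) \<and>
       (\<forall>i<n. \<forall>j<n. i \<noteq> j \<longrightarrow> verts (Fs ! i) \<inter> verts (Fs ! j) = {})"
      using H by (intro exI[of _ "map H [0..<n]"]) auto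
  qed
qed

end
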